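(* Let $R=k[x_1,\ldots,x_n]$ be a polynomial ring over a field $k$ in $n$ variables with its standard grading, let $M$ be a finitely generated graded $R$-module, and let $t\ge0$ be an integer. Then (a) $\operatorname{reg}_t(M)=\max\{b_i(M)-i\mid i\ge n-t\}$; (b) $a^*_t(M)=\max\{b_i(M)\mid i\ge n-t\}-n$.
   Context: $R_+=(x_1,\ldots,x_n)$. $H^i_{R_+}(M)$ is the $i$-th (graded) local cohomology module of $M$ with respect to $R_+$, and $a_i(M)=\sup\{r\mid H^i_{R_+}(M)_r\ne0\}$ (with $a_i(M)=-\infty$ if $H^i_{R_+}(M)=0$). The partial regularities are $\operatorname{reg}_t(M)=\max\{a_i(M)+i\mid 0\le i\le t\}$ and $a_t^*(M)=\max\{a_i(M)\mid 0\le i\le t\}$. $b_i(M)$ is the maximal degree of the generators of $F_i$ in a minimal graded free resolution $0\to F_s\to\cdots\to F_0\to M\to0$, with $b_i(M)=-\infty$ if $F_i=0$ (in particular for $i<0$ or $i>s$). *)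

theory Defs
  imports
    "HOL-Library.Poly_Mapping"
    "HOL-Library.Extended_Real"
    "HOL-Library.Cardinality"
begin

text \<open>The ring \<open>k[x\<^sub>i | i \<in> 'n]\<close>, as the monoid algebra of the exponent vectors; the number of
  variables is \<open>CARD('n)\<close>.\<close>

type_synonym ('n, 'k) mpoly = "('n \<Rightarrow>\<^sub>0 nat) \<Rightarrow>\<^sub>0 'k"

definition var :: "'n \<Rightarrow> ('n::finite, 'k::field) mpoly" where
  "var i = Poly_Mapping.single (Poly_Mapping.single i 1) 1"

definition homogeneous :: "nat \<Rightarrow> ('n::finite, 'k::field) mpoly set" where
  "homogeneous e = {p. \<forall>m \<in> Poly_Mapping.keys p. (\<Sum>i\<in>UNIV. Poly_Mapping.lookup m i) = e}"

text \<open>Ideals are the submodules of the ring over itself, that is, for the scalar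
  multiplication \<open>(*)\<close>.\<close>

definition irrelevant_ideal :: "('n::finite, 'k::field) mpoly set" where
  "irrelevant_ideal = module.span (*) (range var)"

primrec ideal_power :: "('n::finite, 'k::field) mpoly set \<Rightarrow> nat \<Rightarrow> ('n, 'k) mpoly set" where
  "ideal_power J 0 = UNIV"
| "ideal_power J (Suc l) = module.span (*) {p * q | p q. p \<in> J \<and> q \<in> ideal_power J l}"


text \<open>A graded module is given by its scalar multiplication \<open>s\<close> and the family \<open>G\<close> of its
  homogeneous components, which may lie in a larger ambient module. The module itself is
  the (internal) direct sum of the components, \<open>gcarrier G\<close>. The ambient module is
  there so that the terms of a complex can share one type.\<close>

definition gcarrier :: "(int \<Rightarrow> 'm::ab_group_add set) \<Rightarrow> 'm set" where
  "gcarrier G = {\<Sum>d\<in>D. f d | D f. finite D \<and> (\<forall>d\<in>D. f d \<in> G d)}"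

definition graded_module ::
  "(('n::finite, 'k::field) mpoly \<Rightarrow> 'm::ab_group_add \<Rightarrow> 'm) \<Rightarrow> (int \<Rightarrow> 'm set) \<Rightarrow> bool" where
  "graded_module s G \<longleftrightarrow>
     module s \<and>
     (\<forall>d. 0 \<in> G d \<and> (\<forall>x\<in>G d. \<forall>y\<in>G d. x - y \<in> G d)) \<and>
     (\<forall>e d. \<forall>p\<in>homogeneous e. \<forall>x\<in>G d. s p x \<in> G (d + int e)) \<and>
     (\<forall>D f. finite D \<longrightarrow> (\<forall>d\<in>D. f d \<in> G d) \<longrightarrow> (\<Sum>d\<in>D. f d) = 0 \<longrightarrow> (\<forall>d\<in>D. f d = 0))"

definition finitely_generated ::
  "(('n::finite, 'k::field) mpoly \<Rightarrow> 'm::ab_group_add \<Rightarrow> 'm) \<Rightarrow> (int \<Rightarrow> 'm set) \<Rightarrow> bool" where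
  "finitely_generated s G \<longleftrightarrow> (\<exists>S. finite S \<and> S \<subseteq> gcarrier G \<and> module.span s S = gcarrier G)"

text \<open>Homomorphisms of degree 0; only the values on the carrier matter.\<close>

definition graded_hom ::
  "(('n::finite, 'k::field) mpoly \<Rightarrow> 'a::ab_group_add \<Rightarrow> 'a) \<Rightarrow> (int \<Rightarrow> 'a set) \<Rightarrow>
   (('n, 'k) mpoly \<Rightarrow> 'b::ab_group_add \<Rightarrow> 'b) \<Rightarrow> (int \<Rightarrow> 'b set) \<Rightarrow> ('a \<Rightarrow> 'b) \<Rightarrow> bool" where
  "graded_hom s G s' G' f \<longleftrightarrow>
     (\<forall>x\<in>gcarrier G. \<forall>y\<in>gcarrier G. f (x + y) = f x + f y) \<and>
     (\<forall>p. \<forall>x\<in>gcarrier G. f (s p x) = s' p (f x)) \<and>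
     (\<forall>d. f ` G d \<subseteq> G' d)"


text \<open>Injectivity in the category of graded modules and homomorphisms of degree 0. HOL
  cannot quantify over the type of the test modules \<open>A \<subseteq> B\<close>, so they range over all graded
  modules on the type of the ring. These include the homogeneous ideals of all shifts of the
  ring, so by Baer's criterion nothing is lost. Moreover injectivity is only used as a
  hypothesis, where fewer test modules make for a weaker assumption.\<close>

definition graded_injective ::
  "(('n::finite, 'k::field) mpoly \<Rightarrow> 'e::ab_group_add \<Rightarrow> 'e) \<Rightarrow> (int \<Rightarrow> 'e set) \<Rightarrow> bool" where
  "graded_injective s E \<longleftrightarrow>
     graded_module s E \<and>
     (\<forall>(sB :: ('n, 'k) mpoly \<Rightarrow> ('n, 'k) mpoly \<Rightarrow> ('n, 'k) mpoly) A B f.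
        graded_module sB B \<and> graded_module sB A \<and> (\<forall>d. A d \<subseteq> B d) \<and> graded_hom sB A s E f \<longrightarrow>
        (\<exists>g. graded_hom sB B s E g \<and> (\<forall>x\<in>gcarrier A. g x = f x)))"

text \<open>\<open>0 \<rightarrow> M \<rightarrow> I\<^sup>0 \<rightarrow> I\<^sup>1 \<rightarrow> \<dots>\<close> exact, with coaugmentation \<open>\<eta>\<close> and \<open>dI i\<close> mapping \<open>I i\<close> to
  \<open>I (Suc i)\<close>.\<close>

definition graded_injective_resolution ::
  "(('n::finite, 'k::field) mpoly \<Rightarrow> 'm::ab_group_add \<Rightarrow> 'm) \<Rightarrow> (int \<Rightarrow> 'm set) \<Rightarrow>
   (('n, 'k) mpoly \<Rightarrow> 'e::ab_group_add \<Rightarrow> 'e) \<Rightarrow> (nat \<Rightarrow> int \<Rightarrow> 'e set) \<Rightarrow>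
   ('m \<Rightarrow> 'e) \<Rightarrow> (nat \<Rightarrow> 'e \<Rightarrow> 'e) \<Rightarrow> bool" where
  "graded_injective_resolution s M sI I \<eta> dI \<longleftrightarrow>
     (\<forall>i. graded_injective sI (I i)) \<and>
     graded_hom s M sI (I 0) \<eta> \<and>
     (\<forall>i. graded_hom sI (I i) sI (I (Suc i)) (dI i)) \<and>
     inj_on \<eta> (gcarrier M) \<and>
     \<eta> ` gcarrier M = {x \<in> gcarrier (I 0). dI 0 x = 0} \<and>
     (\<forall>i. dI i ` gcarrier (I i) = {x \<in> gcarrier (I (Suc i)). dI (Suc i) x = 0})"

text \<open>The degree \<open>r\<close> component of \<open>\<Gamma>\<^sub>J(N)\<close>, the submodule of the elements annihilated by some
  power of the ideal \<open>J\<close>.\<close>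

definition torsion_part ::
  "('n::finite, 'k::field) mpoly set \<Rightarrow> (('n, 'k) mpoly \<Rightarrow> 'e::ab_group_add \<Rightarrow> 'e) \<Rightarrow>
   (int \<Rightarrow> 'e set) \<Rightarrow> int \<Rightarrow> 'e set" where
  "torsion_part J s N r = {x \<in> N r. \<exists>l. \<forall>p\<in>ideal_power J l. s p x = 0}"

text \<open>Local cohomology as the right derived functor of \<open>\<Gamma>\<close> for \<open>R\<^sub>+\<close>: the degree \<open>r\<close> component
  of the \<open>i\<close>-th cohomology module of the complex \<open>\<Gamma>(I)\<close>, for an injective resolution \<open>I\<close>.\<close>

definition lc_cocycles ::
  "(('n::finite, 'k::field) mpoly \<Rightarrow> 'e::ab_group_add \<Rightarrow> 'e) \<Rightarrow> (nat \<Rightarrow> int \<Rightarrow> 'e set) \<Rightarrow>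
   (nat \<Rightarrow> 'e \<Rightarrow> 'e) \<Rightarrow> nat \<Rightarrow> int \<Rightarrow> 'e set" where
  "lc_cocycles sI I dI i r = {z \<in> torsion_part irrelevant_ideal sI (I i) r. dI i z = 0}"

definition lc_coboundaries ::
  "(('n::finite, 'k::field) mpoly \<Rightarrow> 'e::ab_group_add \<Rightarrow> 'e) \<Rightarrow> (nat \<Rightarrow> int \<Rightarrow> 'e set) \<Rightarrow>
   (nat \<Rightarrow> 'e \<Rightarrow> 'e) \<Rightarrow> nat \<Rightarrow> int \<Rightarrow> 'e set" where
  "lc_coboundaries sI I dI i r =
     (case i of 0 \<Rightarrow> {0} | Suc j \<Rightarrow> dI j ` torsion_part irrelevant_ideal sI (I j) r)"

definition local_cohomology ::
  "(('n::finite, 'k::field) mpoly \<Rightarrow> 'e::ab_group_add \<Rightarrow> 'e) \<Rightarrow> (nat \<Rightarrow> int \<Rightarrow> 'e set) \<Rightarrow>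
   (nat \<Rightarrow> 'e \<Rightarrow> 'e) \<Rightarrow> nat \<Rightarrow> int \<Rightarrow> 'e set set" where
  "local_cohomology sI I dI i r =
     lc_cocycles sI I dI i r //
       {(x, y). x \<in> lc_cocycles sI I dI i r \<and> y \<in> lc_cocycles sI I dI i r \<and>
                x - y \<in> lc_coboundaries sI I dI i r}"

text \<open>The zero class of the quotient is the coset \<open>lc_coboundaries sI I dI i r\<close>. In \<open>ereal\<close>,
  \<open>Sup {} = -\<infinity>\<close>.\<close>

definition a_inv ::
  "(('n::finite, 'k::field) mpoly \<Rightarrow> 'e::ab_group_add \<Rightarrow> 'e) \<Rightarrow> (nat \<Rightarrow> int \<Rightarrow> 'e set) \<Rightarrow>
   (nat \<Rightarrow> 'e \<Rightarrow> 'e) \<Rightarrow> nat \<Rightarrow> ereal" where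
  "a_inv sI I dI i =
     Sup {ereal (real_of_int r) | r. local_cohomology sI I dI i r \<noteq> {lc_coboundaries sI I dI i r}}"

definition partial_reg ::
  "(('n::finite, 'k::field) mpoly \<Rightarrow> 'e::ab_group_add \<Rightarrow> 'e) \<Rightarrow> (nat \<Rightarrow> int \<Rightarrow> 'e set) \<Rightarrow>
   (nat \<Rightarrow> 'e \<Rightarrow> 'e) \<Rightarrow> nat \<Rightarrow> ereal" where
  "partial_reg sI I dI t = Max {a_inv sI I dI i + ereal (real i) | i. i \<le> t}"

definition partial_a_star ::
  "(('n::finite, 'k::field) mpoly \<Rightarrow> 'e::ab_group_add \<Rightarrow> 'e) \<Rightarrow> (nat \<Rightarrow> int \<Rightarrow> 'e set) \<Rightarrow>
   (nat \<Rightarrow> 'e \<Rightarrow> 'e) \<Rightarrow> nat \<Rightarrow> ereal" where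
  "partial_a_star sI I dI t = Max {a_inv sI I dI i | i. i \<le> t}"


definition homogeneous_basis ::
  "(('n::finite, 'k::field) mpoly \<Rightarrow> 'f::ab_group_add \<Rightarrow> 'f) \<Rightarrow> (int \<Rightarrow> 'f set) \<Rightarrow> 'f set \<Rightarrow> bool"
  where
  "homogeneous_basis s F B \<longleftrightarrow>
     finite B \<and> B \<subseteq> (\<Union>r. F r) \<and> \<not> module.dependent s B \<and> module.span s B = gcarrier F"

text \<open>\<open>0 \<rightarrow> F\<^sub>l \<rightarrow> \<dots> \<rightarrow> F\<^sub>0 \<rightarrow> M \<rightarrow> 0\<close> exact, with augmentation \<open>\<epsilon>\<close>, \<open>\<delta> i\<close> mapping \<open>F (Suc i)\<close> to
  \<open>F i\<close>, and \<open>B i\<close> the chosen homogeneous generators of \<open>F i\<close>. Minimality means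
  \<open>\<delta>(F\<^sub>i\<^sub>+\<^sub>1) \<subseteq> R\<^sub>+ F\<^sub>i\<close>.\<close>

definition minimal_graded_free_resolution ::
  "(('n::finite, 'k::field) mpoly \<Rightarrow> 'm::ab_group_add \<Rightarrow> 'm) \<Rightarrow> (int \<Rightarrow> 'm set) \<Rightarrow>
   (('n, 'k) mpoly \<Rightarrow> 'f::ab_group_add \<Rightarrow> 'f) \<Rightarrow> (nat \<Rightarrow> int \<Rightarrow> 'f set) \<Rightarrow> (nat \<Rightarrow> 'f set) \<Rightarrow>
   ('f \<Rightarrow> 'm) \<Rightarrow> (nat \<Rightarrow> 'f \<Rightarrow> 'f) \<Rightarrow> bool" where
  "minimal_graded_free_resolution s M sF F B \<epsilon> \<delta> \<longleftrightarrow>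
     (\<forall>i. graded_module sF (F i) \<and> homogeneous_basis sF (F i) (B i)) \<and>
     (\<exists>l. \<forall>i>l. gcarrier (F i) = {0}) \<and>
     graded_hom sF (F 0) s M \<epsilon> \<and>
     (\<forall>i. graded_hom sF (F (Suc i)) sF (F i) (\<delta> i)) \<and>
     \<epsilon> ` gcarrier (F 0) = gcarrier M \<and>
     \<delta> 0 ` gcarrier (F 1) = {x \<in> gcarrier (F 0). \<epsilon> x = 0} \<and>
     (\<forall>i. \<delta> (Suc i) ` gcarrier (F (Suc (Suc i))) = {x \<in> gcarrier (F (Suc i)). \<delta> i x = 0}) \<and>
     (\<forall>i. \<delta> i ` gcarrier (F (Suc i)) \<subseteq>
        module.span sF {sF p x | p x. p \<in> irrelevant_ideal \<and> x \<in> gcarrier (F i)})"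

definition b_inv :: "(nat \<Rightarrow> int \<Rightarrow> 'f set) \<Rightarrow> (nat \<Rightarrow> 'f set) \<Rightarrow> int \<Rightarrow> ereal" where
  "b_inv F B i =
     (if i < 0 then -\<infinity> else Sup {ereal (real_of_int r) | r. B (nat i) \<inter> F (nat i) r \<noteq> {}})"

end

theory Submission
  imports Defs "HOL-Library.Function_Algebras"
begin

text \<open>Let \<open>n\<close> be the number of variables. Two facts are combined.

  First, \<open>Ext\<^sup>i(k, M)\<^sub>r\<close>, the cohomology of the socles of an injective resolution, is nonzero iff
  \<open>F\<^sub>n\<^sub>-\<^sub>i\<close> has a generator of degree \<open>r + n\<close>: both conditions are equivalent to the nonvanishing of
  the Koszul cohomology \<open>H\<^sup>i(x; M)\<^sub>r\<close>, by dimension shifting along the two resolutions. Koszul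
  cohomology of an injective module lives in degree \<open>0\<close> only, and that of a free module in degree
  \<open>n\<close> only.

  Second, local cohomology is compared with \<open>Ext(k, M)\<close>. If \<open>Ext\<^sup>i(k, M)\<close> vanishes in all degrees
  \<open>\<ge> r\<close>, then so does \<open>H\<^sup>i(M)\<^sub>r\<close>; and if \<open>Ext\<^sup>i(k, M)\<^sub>r \<noteq> 0\<close> while \<open>Ext\<^sup>i\<^sup>-\<^sup>1(k, M)\<close> vanishes in all
  degrees \<open>> r\<close>, then \<open>H\<^sup>i(M)\<^sub>r \<noteq> 0\<close>. Induction on \<open>i\<close> gives, from \<open>Ext\<^sup>i(k, M)\<^sub>r \<noteq> 0\<close>, some
  \<open>i' \<le> i\<close> and \<open>r'\<close> with \<open>r' + i' \<ge> r + i\<close> and \<open>H\<^sup>i\<^sup>'(M)\<^sub>r\<^sub>' \<noteq> 0\<close>, which yields both formulas.\<close>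

section \<open>Koszul complexes\<close>

text \<open>Koszul cochains for a list of \<open>n\<close> variables are indexed by Boolean lists of length \<open>n\<close>, the
  characteristic functions of subsets. In internal degree \<open>r\<close>, a cochain of cohomological degree \<open>p\<close>
  takes values in \<open>N (r + p)\<close>. Degrees are integers, so that \<open>p - 1\<close> is not truncated.\<close>

definition ones :: "bool list \<Rightarrow> int" where
  "ones bs = int (count_list bs True)"

lemma ones_simps [simp]: "ones [] = 0" "ones (b # bs) = ones bs + of_bool b"
  by (simp_all add: ones_def)

lemma ones_nonneg [simp]: "0 \<le> ones bs"
  by (simp add: ones_def)

lemma ones_le_length: "ones bs \<le> int (length bs)"
  by (simp add: ones_def count_le_length)

lemma ones_eq_0_iff: "length bs = n \<and> ones bs = 0 \<longleftrightarrow> bs = replicate n False"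
proof (induction bs arbitrary: n)
  case (Cons b bs)
  show ?case using Cons[of "n - 1"] ones_nonneg[of bs] by (cases n) (auto simp del: ones_nonneg)
qed auto

lemma ones_eq_length_iff: "length bs = n \<and> ones bs = int n \<longleftrightarrow> bs = replicate n True"
proof (induction bs arbitrary: n)
  case (Cons b bs)
  show ?case using Cons[of "n - 1"] ones_le_length[of bs] by (cases n) auto
qed auto

definition cochains :: "nat \<Rightarrow> int \<Rightarrow> int \<Rightarrow> (int \<Rightarrow> 'a::zero set) \<Rightarrow> (bool list \<Rightarrow> 'a) set" where
  "cochains n p r N = {f. \<forall>bs. f bs \<in> (if length bs = n \<and> ones bs = p then N (r + p) else {0})}"

lemma cochains_trivial:
  assumes "p < 0 \<or> p > int n"
  shows "cochains n p r N = {0}"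
proof -
  have "\<not> (length bs = n \<and> ones bs = p)" for bs
    using assms ones_le_length[of bs] ones_nonneg[of bs] by linarith
  then show ?thesis by (auto simp: cochains_def fun_eq_iff)
qed

definition single_cochain :: "bool list \<Rightarrow> 'a::zero \<Rightarrow> bool list \<Rightarrow> 'a" where
  "single_cochain cs e = 0(cs := e)"

lemma inj_single_cochain: "inj (single_cochain cs)"
  by (rule injI) (metis fun_upd_same single_cochain_def)

lemma single_cochain_eq_0_iff [simp]: "single_cochain cs e = 0 \<longleftrightarrow> e = 0"
  by (auto simp: single_cochain_def fun_eq_iff)

lemma single_cochain_diff:
  "single_cochain cs a - single_cochain cs b = single_cochain cs (a - b :: 'a::group_add)"
  by (auto simp: single_cochain_def fun_eq_iff)

lemma comp_single_cochain: "\<phi> 0 = 0 \<Longrightarrow> \<phi> \<circ> single_cochain cs e = single_cochain cs (\<phi> e)"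
  by (auto simp: single_cochain_def fun_eq_iff)

lemma cochains_eq_image_single_cochain:
  assumes "\<And>bs. length bs = n \<and> ones bs = p \<longleftrightarrow> bs = cs"
  shows "cochains n p r N = single_cochain cs ` N (r + p)"
proof
  show "cochains n p r N \<subseteq> single_cochain cs ` N (r + p)"
  proof
    fix f assume f: "f \<in> cochains n p r N"
    then have f_value: "f bs \<in> (if bs = cs then N (r + p) else {0})" for bs
      unfolding cochains_def mem_Collect_eq assms by blast
    then have "f cs \<in> N (r + p)" by (metis (full_types))
    moreover have "f bs = 0" if "bs \<noteq> cs" for bs using f_value[of bs] that by simp
    then have "f = single_cochain cs (f cs)" by (auto simp: single_cochain_def fun_eq_iff)
    ultimately show "f \<in> single_cochain cs ` N (r + p)" by blast
  qed
  show "single_cochain cs ` N (r + p) \<subseteq> cochains n p r N"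
    by (auto simp: cochains_def assms single_cochain_def)
qed

lemma cochains_0: "cochains n 0 r N = single_cochain (replicate n False) ` N r"
  using cochains_eq_image_single_cochain[OF ones_eq_0_iff, of n r N] by simp

lemma cochains_top: "cochains n (int n) r N = single_cochain (replicate n True) ` N (r + int n)"
  by (rule cochains_eq_image_single_cochain[OF ones_eq_length_iff])

definition join :: "(bool list \<Rightarrow> 'a::zero) \<Rightarrow> (bool list \<Rightarrow> 'a) \<Rightarrow> bool list \<Rightarrow> 'a" where
  "join f g bs = (case bs of [] \<Rightarrow> 0 | b # cs \<Rightarrow> if b then g cs else f cs)"

lemma join_simps [simp]:
  "join f g [] = 0" "join f g (False # bs) = f bs" "join f g (True # bs) = g bs"
  by (simp_all add: join_def)

lemma join_comp_Cons [simp]: "join f g \<circ> (#) False = f" "join f g \<circ> (#) True = g"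
  by (simp_all add: fun_eq_iff)

lemma eq_joinI: "h [] = 0 \<Longrightarrow> h = join (h \<circ> (#) False) (h \<circ> (#) True)"
  by (auto simp: fun_eq_iff join_def split: list.splits)

lemma join_eq_join_iff [simp]: "join f g = join f' g' \<longleftrightarrow> f = f' \<and> g = g'"
  by (metis join_comp_Cons)

lemma join_0_0 [simp]: "join 0 0 = 0"
  by (auto simp: fun_eq_iff join_def split: list.splits)

lemma join_eq_0_iff [simp]: "join f g = 0 \<longleftrightarrow> f = 0 \<and> g = 0"
  by (metis join_0_0 join_eq_join_iff)

lemma join_diff: "join f g - join f' g' = join (f - f') (g - g' :: bool list \<Rightarrow> 'a::group_add)"
  by (auto simp: fun_eq_iff join_def split: list.splits)

lemma comp_join: "\<phi> 0 = 0 \<Longrightarrow> \<phi> \<circ> join f g = join (\<phi> \<circ> f) (\<phi> \<circ> g)"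
  by (auto simp: fun_eq_iff join_def split: list.splits)

lemma single_cochain_Cons_True: "single_cochain (True # cs) e = join 0 (single_cochain cs e)"
  by (auto simp: fun_eq_iff single_cochain_def join_def split: list.splits)

lemma single_cochain_Cons_False: "single_cochain (False # cs) e = join (single_cochain cs e) 0"
  by (auto simp: fun_eq_iff single_cochain_def join_def split: list.splits)

lemma join_in_cochains_iff [simp]:
  "join f g \<in> cochains (Suc n) p r N \<longleftrightarrow> f \<in> cochains n p r N \<and> g \<in> cochains n (p - 1) (r + 1) N"
proof -
  have "join f g \<in> cochains (Suc n) p r N \<longleftrightarrow> (\<forall>b bs. join f g (b # bs) \<in>
      (if length (b # bs) = Suc n \<and> ones (b # bs) = p then N (r + p) else {0}))"
    unfolding cochains_def mem_Collect_eq
    by (metis (no_types, lifting) join_simps(1) length_0_conv list.exhaust nat.distinct(1)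
        singletonI)
  then show ?thesis
    by (auto simp: cochains_def all_bool_eq eq_diff_eq)
qed

lemma cochains_SucE:
  assumes "h \<in> cochains (Suc n) p r N"
  obtains f g where "h = join f g" "f \<in> cochains n p r N" "g \<in> cochains n (p - 1) (r + 1) N"
proof -
  have "h [] = 0" using assms by (auto simp: cochains_def dest: spec[of _ "[]"])
  then show thesis using that assms eq_joinI join_in_cochains_iff by metis
qed

text \<open>The Koszul complex as an iterated mapping cone, with differential \<open>(f, g) \<mapsto> (df, w f - dg)\<close>.\<close>

primrec koszul_d ::
  "('n \<Rightarrow> 'a::ab_group_add \<Rightarrow> 'a) \<Rightarrow> 'n list \<Rightarrow> (bool list \<Rightarrow> 'a) \<Rightarrow> bool list \<Rightarrow> 'a" where
  "koszul_d x [] f = 0"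
| "koszul_d x (w # vs) f =
     join (koszul_d x vs (f \<circ> (#) False))
          ((x w \<circ> (f \<circ> (#) False)) - koszul_d x vs (f \<circ> (#) True))"

definition koszul_cocycles ::
  "('n \<Rightarrow> 'a::ab_group_add \<Rightarrow> 'a) \<Rightarrow> (int \<Rightarrow> 'a set) \<Rightarrow> 'n list \<Rightarrow> int \<Rightarrow> int \<Rightarrow> (bool list \<Rightarrow> 'a) set" where
  "koszul_cocycles x N vs p r = {f \<in> cochains (length vs) p r N. koszul_d x vs f = 0}"

definition koszul_coboundaries ::
  "('n \<Rightarrow> 'a::ab_group_add \<Rightarrow> 'a) \<Rightarrow> (int \<Rightarrow> 'a set) \<Rightarrow> 'n list \<Rightarrow> int \<Rightarrow> int \<Rightarrow> (bool list \<Rightarrow> 'a) set" where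
  "koszul_coboundaries x N vs p r = koszul_d x vs ` cochains (length vs) (p - 1) r N"

definition koszul_acyclic ::
  "('n \<Rightarrow> 'a::ab_group_add \<Rightarrow> 'a) \<Rightarrow> (int \<Rightarrow> 'a set) \<Rightarrow> 'n list \<Rightarrow> int \<Rightarrow> int \<Rightarrow> bool" where
  "koszul_acyclic x N vs p r \<longleftrightarrow> koszul_cocycles x N vs p r \<subseteq> koszul_coboundaries x N vs p r"

definition annihilated :: "('n \<Rightarrow> 'a::zero \<Rightarrow> 'a) \<Rightarrow> (int \<Rightarrow> 'a set) \<Rightarrow> 'n set \<Rightarrow> int \<Rightarrow> 'a set" where
  "annihilated x N V d = {e \<in> N d. \<forall>v\<in>V. x v e = 0}"

primrec multiples :: "('n \<Rightarrow> 'a::ab_group_add \<Rightarrow> 'a) \<Rightarrow> (int \<Rightarrow> 'a set) \<Rightarrow> 'n list \<Rightarrow> int \<Rightarrow> 'a set" where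
  "multiples x N [] d = {0}"
| "multiples x N (w # vs) d = {x w a + b | a b. a \<in> N (d - 1) \<and> b \<in> multiples x N vs d}"

text \<open>Regular and coregular sequences are read from the end of the list: \<open>w\<close> acts injectively on
  \<open>N/(vs)N\<close>, and surjectively on the elements killed by \<open>vs\<close>, respectively.\<close>

primrec regular :: "('n \<Rightarrow> 'a::ab_group_add \<Rightarrow> 'a) \<Rightarrow> (int \<Rightarrow> 'a set) \<Rightarrow> 'n list \<Rightarrow> bool" where
  "regular x N [] \<longleftrightarrow> True"
| "regular x N (w # vs) \<longleftrightarrow> regular x N vs \<and>
     (\<forall>d. \<forall>e\<in>N d. x w e \<in> multiples x N vs (d + 1) \<longrightarrow> e \<in> multiples x N vs d)"

primrec coregular :: "('n \<Rightarrow> 'a::ab_group_add \<Rightarrow> 'a) \<Rightarrow> (int \<Rightarrow> 'a set) \<Rightarrow> 'n list \<Rightarrow> bool" where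
  "coregular x N [] \<longleftrightarrow> True"
| "coregular x N (w # vs) \<longleftrightarrow> coregular x N vs \<and>
     (\<forall>d. annihilated x N (set vs) d \<subseteq> x w ` annihilated x N (set vs) (d - 1))"

locale koszul_module =
  fixes x :: "'n \<Rightarrow> 'a::ab_group_add \<Rightarrow> 'a" and N :: "int \<Rightarrow> 'a set"
  assumes x_add: "x v (a + b) = x v a + x v b"
    and x_comm: "x u (x v a) = x v (x u a)"
    and zero_mem: "0 \<in> N d"
    and diff_mem: "a \<in> N d \<Longrightarrow> b \<in> N d \<Longrightarrow> a - b \<in> N d"
    and x_mem: "a \<in> N d \<Longrightarrow> x v a \<in> N (d + 1)"
begin

lemma x_zero [simp]: "x v 0 = 0"
  using x_add[of v 0 0] by simp

lemma x_diff: "x v (a - b) = x v a - x v b"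
  using x_add[of v "a - b" b] by (simp add: algebra_simps)

lemma uminus_mem: "a \<in> N d \<Longrightarrow> - a \<in> N d"
  using diff_mem[OF zero_mem] by force

lemma add_mem: "a \<in> N d \<Longrightarrow> b \<in> N d \<Longrightarrow> a + b \<in> N d"
  using diff_mem uminus_mem by (metis diff_minus_eq_add)

lemma sum_mem: "(\<And>j. j \<in> J \<Longrightarrow> t j \<in> N d) \<Longrightarrow> sum t J \<in> N d"
  by (induction J rule: infinite_finite_induct) (auto simp: zero_mem add_mem)

lemma zero_in_cochains: "0 \<in> cochains n p r N"
  by (simp add: cochains_def zero_mem)

lemma cochains_diff: "f \<in> cochains n p r N \<Longrightarrow> g \<in> cochains n p r N \<Longrightarrow> f - g \<in> cochains n p r N"
  unfolding cochains_def by (force intro: diff_mem split: if_splits)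

lemma cochains_uminus: "f \<in> cochains n p r N \<Longrightarrow> - f \<in> cochains n p r N"
  using cochains_diff[OF zero_in_cochains] by force

lemma cochains_add: "f \<in> cochains n p r N \<Longrightarrow> g \<in> cochains n p r N \<Longrightarrow> f + g \<in> cochains n p r N"
  using cochains_diff[OF _ cochains_uminus] by force

lemma cochains_x: "f \<in> cochains n p r N \<Longrightarrow> x v \<circ> f \<in> cochains n p (r + 1) N"
  unfolding cochains_def using x_mem[of _ "r + p" v] by (force simp: algebra_simps split: if_splits)

lemma koszul_d_diff: "koszul_d x vs (f - g) = koszul_d x vs f - koszul_d x vs g"
proof (induction vs arbitrary: f g)
  case (Cons w vs)
  have tails: "(f - g) \<circ> (#) b = (f \<circ> (#) b) - (g \<circ> (#) b)" for b
    by (simp add: fun_eq_iff)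
  have linear: "x w \<circ> (f' - g') = (x w \<circ> f') - (x w \<circ> g')"
      for f' g' :: "bool list \<Rightarrow> 'a"
    by (simp add: fun_eq_iff x_diff)
  show ?case
    by (simp only: koszul_d.simps tails linear Cons join_diff) (simp only: algebra_simps)
qed simp

lemma koszul_d_zero [simp]: "koszul_d x vs 0 = 0"
  using koszul_d_diff[of vs 0 0] by simp

lemma koszul_d_uminus: "koszul_d x vs (- f) = - koszul_d x vs f"
  using koszul_d_diff[of vs 0 f] by simp

lemma koszul_d_add: "koszul_d x vs (f + g) = koszul_d x vs f + koszul_d x vs g"
  using koszul_d_diff[of vs f "- g"] by (simp add: koszul_d_uminus)

lemma koszul_d_x: "koszul_d x vs (x v \<circ> f) = x v \<circ> koszul_d x vs f"
proof (induction vs arbitrary: f)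
  case (Cons w vs)
  have commute: "(x w \<circ> (x v \<circ> f')) - (x v \<circ> g') = x v \<circ> ((x w \<circ> f') - g')"
      for f' g' :: "bool list \<Rightarrow> 'a"
    by (simp add: fun_eq_iff x_diff x_comm[of v w])
  show ?case
    by (simp only: koszul_d.simps comp_assoc Cons commute comp_join x_zero)
qed (simp add: fun_eq_iff)

lemma koszul_d_koszul_d [simp]: "koszul_d x vs (koszul_d x vs f) = 0"
  by (induction vs arbitrary: f) (simp_all add: koszul_d_diff koszul_d_x)

lemma koszul_d_mem:
  "f \<in> cochains (length vs) p r N \<Longrightarrow> koszul_d x vs f \<in> cochains (length vs) (p + 1) r N"
proof (induction vs arbitrary: f p r)
  case (Cons w vs)
  then obtain g h where gh: "f = join g h"
      "g \<in> cochains (length vs) p r N" "h \<in> cochains (length vs) (p - 1) (r + 1) N"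
    by (auto elim: cochains_SucE)
  then show ?case
    using Cons.IH[OF gh(2)] Cons.IH[OF gh(3)] cochains_diff cochains_x[OF gh(2)] by auto
qed (simp add: zero_in_cochains)

lemma zero_in_koszul_cocycles: "0 \<in> koszul_cocycles x N vs p r"
  by (simp add: koszul_cocycles_def zero_in_cochains)

lemma zero_in_koszul_coboundaries: "0 \<in> koszul_coboundaries x N vs p r"
  unfolding koszul_coboundaries_def using zero_in_cochains koszul_d_zero by (metis imageI)

lemma koszul_d_in_coboundaries:
  "f \<in> cochains (length vs) (p - 1) r N \<Longrightarrow> koszul_d x vs f \<in> koszul_coboundaries x N vs p r"
  unfolding koszul_coboundaries_def by (rule imageI)

lemma koszul_coboundaries_subset_cocycles:
  "koszul_coboundaries x N vs p r \<subseteq> koszul_cocycles x N vs p r"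
  using koszul_d_mem[of _ vs "p - 1" r] by (auto simp: koszul_coboundaries_def koszul_cocycles_def)

lemma koszul_acyclic_iff_eq:
  "koszul_acyclic x N vs p r \<longleftrightarrow> koszul_cocycles x N vs p r = koszul_coboundaries x N vs p r"
  unfolding koszul_acyclic_def using koszul_coboundaries_subset_cocycles by blast

lemma koszul_coboundaries_Cons:
  "koszul_coboundaries x N (w # vs) p r =
     {join (koszul_d x vs f) ((x w \<circ> f) - g) | f g.
        f \<in> cochains (length vs) (p - 1) r N \<and> g \<in> koszul_coboundaries x N vs (p - 1) (r + 1)}"
    (is "?B = ?J")
proof
  show "?B \<subseteq> ?J"
    by (force simp: koszul_coboundaries_def elim!: cochains_SucE)
  show "?J \<subseteq> ?B"
  proof
    fix h assume "h \<in> ?J"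
    then obtain f g where f: "f \<in> cochains (length vs) (p - 1) r N"
        and g: "g \<in> cochains (length vs) (p - 1 - 1) (r + 1) N"
        and h: "h = join (koszul_d x vs f) ((x w \<circ> f) - koszul_d x vs g)"
      by (auto simp: koszul_coboundaries_def)
    then have "join f g \<in> cochains (length (w # vs)) (p - 1) r N"
        "h = koszul_d x (w # vs) (join f g)"
      by simp_all
    then show "h \<in> ?B" by (simp only: koszul_d_in_coboundaries)
  qed
qed

lemma koszul_acyclic_outside:
  assumes "p < 0 \<or> p > int (length vs)"
  shows "koszul_acyclic x N vs p r"
  using zero_in_koszul_coboundaries cochains_trivial[OF assms, of r N]
  by (auto simp: koszul_acyclic_def koszul_cocycles_def)

lemma koszul_d_single_cochain_False_eq_0_iff:
  "koszul_d x vs (single_cochain (replicate (length vs) False) e) = 0 \<longleftrightarrow> (\<forall>v\<in>set vs. x v e = 0)"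
proof (induction vs)
  case (Cons w vs)
  have "koszul_d x (w # vs) (single_cochain (replicate (length (w # vs)) False) e) =
      join (koszul_d x vs (single_cochain (replicate (length vs) False) e))
        (single_cochain (replicate (length vs) False) (x w e))"
    by (simp add: single_cochain_Cons_False comp_single_cochain)
  then show ?case by (simp only: Cons join_eq_0_iff single_cochain_eq_0_iff) auto
qed simp

lemma koszul_cocycles_0:
  "koszul_cocycles x N vs 0 r =
     single_cochain (replicate (length vs) False) ` annihilated x N (set vs) r"
  using koszul_d_single_cochain_False_eq_0_iff[of vs]
  by (auto simp: koszul_cocycles_def cochains_0 annihilated_def)

lemma koszul_coboundaries_0: "koszul_coboundaries x N vs 0 r = {0}"
  using cochains_trivial[of "- 1" "length vs" r N] by (simp add: koszul_coboundaries_def)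

lemma koszul_acyclic_0_iff: "koszul_acyclic x N vs 0 r \<longleftrightarrow> annihilated x N (set vs) r \<subseteq> {0}"
  by (auto simp: koszul_acyclic_def koszul_cocycles_0 koszul_coboundaries_0)

lemma multiples_ConsI:
  "a \<in> N (d - 1) \<Longrightarrow> b \<in> multiples x N vs d \<Longrightarrow> x w a + b \<in> multiples x N (w # vs) d"
  by auto

lemma zero_in_multiples: "0 \<in> multiples x N vs d"
  by (induction vs) (simp, metis multiples_ConsI add_0 x_zero zero_mem)

lemma multiples_diff:
  "a \<in> multiples x N vs d \<Longrightarrow> b \<in> multiples x N vs d \<Longrightarrow> a - b \<in> multiples x N vs d"
proof (induction vs arbitrary: a b)
  case (Cons w vs)
  then obtain a1 a2 b1 b2 where
      "a = x w a1 + a2" "a1 \<in> N (d - 1)" "a2 \<in> multiples x N vs d"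
      "b = x w b1 + b2" "b1 \<in> N (d - 1)" "b2 \<in> multiples x N vs d"
    by auto
  then show ?case
    using multiples_ConsI[OF diff_mem[of a1 "d - 1" b1] Cons.IH[of a2 b2], of w]
    by (simp add: x_diff algebra_simps)
qed simp

lemma multiples_uminus: "a \<in> multiples x N vs d \<Longrightarrow> - a \<in> multiples x N vs d"
  using multiples_diff[OF zero_in_multiples] by force

lemma multiples_add:
  "a \<in> multiples x N vs d \<Longrightarrow> b \<in> multiples x N vs d \<Longrightarrow> a + b \<in> multiples x N vs d"
  using multiples_diff[OF _ multiples_uminus] by force

lemma multiples_sum: "(\<And>j. j \<in> J \<Longrightarrow> t j \<in> multiples x N vs d) \<Longrightarrow> sum t J \<in> multiples x N vs d"
  by (induction J rule: infinite_finite_induct) (auto simp: zero_in_multiples multiples_add)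

lemma multiples_subset: "multiples x N vs d \<subseteq> N d"
proof (induction vs)
  case (Cons w vs)
  then show ?case using add_mem x_mem[of _ "d - 1" w] by auto
qed (simp add: zero_mem)

lemma x_in_multiples: "v \<in> set vs \<Longrightarrow> a \<in> N (d - 1) \<Longrightarrow> x v a \<in> multiples x N vs d"
proof (induction vs)
  case (Cons w vs)
  show ?case
  proof (cases "v = w")
    case True
    then show ?thesis using multiples_ConsI[OF Cons.prems(2) zero_in_multiples, of w vs] by simp
  next
    case False
    then show ?thesis using multiples_ConsI[OF zero_mem Cons.IH, of w] Cons.prems by simp
  qed
qed simp

lemma koszul_cocycles_top:
  "koszul_cocycles x N vs (int (length vs)) r =
     single_cochain (replicate (length vs) True) ` N (r + int (length vs))"
  using koszul_d_mem[of _ vs "int (length vs)" r]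
    cochains_trivial[of "int (length vs) + 1" "length vs" r N]
  by (auto simp: koszul_cocycles_def simp flip: cochains_top)

lemma koszul_coboundaries_top:
  "koszul_coboundaries x N vs (int (length vs)) r =
     single_cochain (replicate (length vs) True) ` multiples x N vs (r + int (length vs))"
proof (induction vs arbitrary: r)
  case Nil
  then show ?case by (simp add: koszul_coboundaries_0)
next
  case (Cons w vs)
  let ?n = "length vs" and ?top = "single_cochain (replicate (length vs) True)"
  let ?X = "multiples x N vs (r + 1 + int ?n)"
  have d_top: "koszul_d x vs (?top a) = 0" if "a \<in> N (r + int ?n)" for a
    using that koszul_cocycles_top[of vs r] by (auto simp: koszul_cocycles_def)
  have "koszul_coboundaries x N (w # vs) (int (length (w # vs))) r =
      {join (koszul_d x vs f) ((x w \<circ> f) - g) | f g.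
        f \<in> cochains ?n (int ?n) r N \<and> g \<in> koszul_coboundaries x N vs (int ?n) (r + 1)}"
    using koszul_coboundaries_Cons[of w vs "int ?n + 1" r] by (simp add: add.commute)
  also have "\<dots> = {join (koszul_d x vs (?top a)) ((x w \<circ> ?top a) - ?top b) | a b.
      a \<in> N (r + int ?n) \<and> b \<in> ?X}"
    unfolding Cons.IH cochains_top by blast
  also have "\<dots> = {join 0 (?top (x w a - b)) | a b. a \<in> N (r + int ?n) \<and> b \<in> ?X}"
    using d_top by (force simp: comp_single_cochain single_cochain_diff)
  also have "\<dots> = single_cochain (replicate (length (w # vs)) True) `
      {x w a - b | a b. a \<in> N (r + int ?n) \<and> b \<in> ?X}"
    by (auto simp: single_cochain_Cons_True)
  also have "{x w a - b | a b. a \<in> N (r + int ?n) \<and> b \<in> ?X} =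
      {x w a + b | a b. a \<in> N (r + int ?n) \<and> b \<in> ?X}"
    (is "?L = ?R")
  proof (intro equalityI subsetI)
    show "e \<in> ?R" if "e \<in> ?L" for e
      using that multiples_uminus by auto (metis diff_conv_add_uminus)
    show "e \<in> ?L" if "e \<in> ?R" for e
      using that multiples_uminus by auto (metis diff_minus_eq_add)
  qed
  also have "\<dots> = multiples x N (w # vs) (r + int (length (w # vs)))"
    by (simp add: algebra_simps)
  finally show ?case .
qed

lemma koszul_acyclic_top_iff:
  "koszul_acyclic x N vs (int (length vs)) r \<longleftrightarrow>
     N (r + int (length vs)) \<subseteq> multiples x N vs (r + int (length vs))"
  unfolding koszul_acyclic_def koszul_cocycles_top koszul_coboundaries_top
  by (simp add: inj_image_subset_iff inj_single_cochain)

text \<open>The long exact sequence of the mapping cone: \<open>w\<close> must be injective on \<open>H\<^sup>p\<close> and surjective on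
  \<open>H\<^sup>p\<^sup>-\<^sup>1\<close>.\<close>

lemma koszul_acyclic_ConsI:
  assumes inj: "\<And>f. f \<in> koszul_cocycles x N vs p r \<Longrightarrow>
      x w \<circ> f \<in> koszul_coboundaries x N vs p (r + 1) \<Longrightarrow> f \<in> koszul_coboundaries x N vs p r"
    and surj: "\<And>g. g \<in> koszul_cocycles x N vs (p - 1) (r + 1) \<Longrightarrow>
      \<exists>h\<in>koszul_cocycles x N vs (p - 1) r.
        g - (x w \<circ> h) \<in> koszul_coboundaries x N vs (p - 1) (r + 1)"
  shows "koszul_acyclic x N (w # vs) p r"
  unfolding koszul_acyclic_def
proof
  fix F assume "F \<in> koszul_cocycles x N (w # vs) p r"
  then obtain f g where F: "F = join f g"
      and f: "f \<in> cochains (length vs) p r N" "koszul_d x vs f = 0"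
      and g: "g \<in> cochains (length vs) (p - 1) (r + 1) N" "x w \<circ> f = koszul_d x vs g"
    by (auto simp: koszul_cocycles_def elim!: cochains_SucE)
  have "f \<in> koszul_coboundaries x N vs p r"
    using inj[of f] f g koszul_d_in_coboundaries by (simp add: koszul_cocycles_def)
  then obtain h where h: "h \<in> cochains (length vs) (p - 1) r N" "koszul_d x vs h = f"
    by (auto simp: koszul_coboundaries_def)
  have "g - (x w \<circ> h) \<in> koszul_cocycles x N vs (p - 1) (r + 1)"
    using g h cochains_diff cochains_x by (simp add: koszul_cocycles_def koszul_d_diff koszul_d_x)
  then obtain h' k where h': "h' \<in> cochains (length vs) (p - 1) r N" "koszul_d x vs h' = 0"
      and k: "k \<in> cochains (length vs) (p - 2) (r + 1) N"
        "g - (x w \<circ> h) - (x w \<circ> h') = koszul_d x vs k"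
    using surj by (fastforce simp: koszul_cocycles_def koszul_coboundaries_def)
  have "(x w \<circ> (h + h')) - koszul_d x vs (- k) = g"
    using k(2) by (simp add: koszul_d_uminus fun_eq_iff x_add algebra_simps)
  then have "koszul_d x (w # vs) (join (h + h') (- k)) = F"
    using F h h' by (simp add: koszul_d_add)
  moreover have "join (h + h') (- k) \<in> cochains (length (w # vs)) (p - 1) r N"
    using h h' k by (simp add: cochains_add cochains_uminus)
  ultimately show "F \<in> koszul_coboundaries x N (w # vs) p r"
    using koszul_d_in_coboundaries by metis
qed

lemma koszul_coboundaries_lift:
  assumes "g \<in> koszul_coboundaries x N vs p (r + 1)"
  shows "\<exists>h\<in>koszul_cocycles x N vs p r. g - (x w \<circ> h) \<in> koszul_coboundaries x N vs p (r + 1)"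
proof
  have "g - (x w \<circ> 0) = g" by (simp add: fun_eq_iff)
  then show "g - (x w \<circ> 0) \<in> koszul_coboundaries x N vs p (r + 1)" using assms by (simp only:)
qed (rule zero_in_koszul_cocycles)

lemma koszul_acyclic_coregular:
  assumes "coregular x N vs" "p > 0"
  shows "koszul_acyclic x N vs p r"
  using assms
proof (induction vs arbitrary: p r)
  case (Cons w vs p r)
  let ?bot = "single_cochain (replicate (length vs) False)"
  have acyclic: "koszul_cocycles x N vs p' r' \<subseteq> koszul_coboundaries x N vs p' r'"
      if "p' > 0" for p' r'
    using Cons.IH[of p' r'] Cons.prems that by (simp add: koszul_acyclic_def)
  show ?case
  proof (rule koszul_acyclic_ConsI)
    fix g assume g: "g \<in> koszul_cocycles x N vs (p - 1) (r + 1)"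
    show "\<exists>h\<in>koszul_cocycles x N vs (p - 1) r.
        g - (x w \<circ> h) \<in> koszul_coboundaries x N vs (p - 1) (r + 1)"
    proof (cases "p = 1")
      case True
      then obtain e where e: "g = ?bot e" "e \<in> annihilated x N (set vs) (r + 1)"
        using g by (auto simp: koszul_cocycles_0)
      then obtain e' where e': "e = x w e'" "e' \<in> annihilated x N (set vs) r"
        using Cons.prems(1) by fastforce
      have "g - (x w \<circ> ?bot e') = 0" using e e' by (simp add: comp_single_cochain)
      moreover have "?bot e' \<in> koszul_cocycles x N vs (p - 1) r"
        using True e' by (simp add: koszul_cocycles_0)
      ultimately show ?thesis using zero_in_koszul_coboundaries by metis
    next
      case False
      then show ?thesis
        using acyclic[of "p - 1" "r + 1"] Cons.prems(2) g by (intro koszul_coboundaries_lift) auto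
    qed
  qed (use acyclic Cons.prems in blast)
qed (simp add: koszul_acyclic_outside)

lemma koszul_acyclic_regular:
  assumes "regular x N vs" "p < int (length vs)"
  shows "koszul_acyclic x N vs p r"
  using assms
proof (induction vs arbitrary: p r)
  case (Cons w vs p r)
  let ?n = "length vs"
  have acyclic: "koszul_cocycles x N vs p' r' \<subseteq> koszul_coboundaries x N vs p' r'"
      if "p' < int ?n" for p' r'
    using Cons.IH[of p' r'] Cons.prems that by (simp add: koszul_acyclic_def)
  show ?case
  proof (rule koszul_acyclic_ConsI)
    fix f assume f: "f \<in> koszul_cocycles x N vs p r"
      "x w \<circ> f \<in> koszul_coboundaries x N vs p (r + 1)"
    show "f \<in> koszul_coboundaries x N vs p r"
    proof (cases "p = int ?n")
      case True
      then obtain e where e: "f = single_cochain (replicate ?n True) e" "e \<in> N (r + int ?n)"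
        using f(1) by (auto simp: koszul_cocycles_top)
      then have "x w e \<in> multiples x N vs (r + int ?n + 1)"
        using f(2) True
        by (simp add: comp_single_cochain koszul_coboundaries_top inj_image_mem_iff
            inj_single_cochain algebra_simps)
      then show ?thesis using Cons.prems(1) e True by (simp add: koszul_coboundaries_top)
    qed (use acyclic[of p r] f(1) Cons.prems(2) in auto)
  next
    fix g assume "g \<in> koszul_cocycles x N vs (p - 1) (r + 1)"
    then show "\<exists>h\<in>koszul_cocycles x N vs (p - 1) r.
        g - (x w \<circ> h) \<in> koszul_coboundaries x N vs (p - 1) (r + 1)"
      using acyclic[of "p - 1" "r + 1"] Cons.prems(2) by (intro koszul_coboundaries_lift) auto
  qed
qed (simp add: koszul_acyclic_outside)

end

section \<open>Short exact sequences\<close>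

locale koszul_short_exact = koszul_module x N + cod: koszul_module y Q
  for x :: "'n \<Rightarrow> 'a::ab_group_add \<Rightarrow> 'a" and N :: "int \<Rightarrow> 'a set"
    and y :: "'n \<Rightarrow> 'b::ab_group_add \<Rightarrow> 'b" and Q :: "int \<Rightarrow> 'b set" +
  fixes \<phi> :: "'a \<Rightarrow> 'b" and K :: "int \<Rightarrow> 'a set"
  assumes \<phi>_add: "a \<in> N d \<Longrightarrow> b \<in> N d \<Longrightarrow> \<phi> (a + b) = \<phi> a + \<phi> b"
    and \<phi>_x: "a \<in> N d \<Longrightarrow> \<phi> (x v a) = y v (\<phi> a)"
    and \<phi>_image: "\<phi> ` N d = Q d"
    and kernel: "K d = {a \<in> N d. \<phi> a = 0}"
begin

lemma \<phi>_zero [simp]: "\<phi> 0 = 0"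
  using \<phi>_add[OF zero_mem zero_mem] by simp

lemma \<phi>_diff: "a \<in> N d \<Longrightarrow> b \<in> N d \<Longrightarrow> \<phi> (a - b) = \<phi> a - \<phi> b"
  using \<phi>_add[OF diff_mem[of a d b], of b] by (simp add: algebra_simps)

sublocale ker: koszul_module x K
proof
  fix a b d v
  show "a \<in> K d \<Longrightarrow> b \<in> K d \<Longrightarrow> a - b \<in> K d"
    using diff_mem \<phi>_diff by (auto simp: kernel)
  show "a \<in> K d \<Longrightarrow> x v a \<in> K (d + 1)"
    using x_mem \<phi>_x by (auto simp: kernel)
qed (auto simp: kernel zero_mem x_add x_comm)

lemma cochains_kernel: "cochains n p r K = {f \<in> cochains n p r N. \<phi> \<circ> f = 0}"
proof -
  have "a \<in> (if c then K d else {0}) \<longleftrightarrow> a \<in> (if c then N d else {0}) \<and> \<phi> a = 0" for a c d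
    by (auto simp: kernel)
  then show ?thesis unfolding cochains_def by (auto simp: fun_eq_iff)
qed

lemma cochains_image: "(\<circ>) \<phi> ` cochains n p r N = cochains n p r Q"
proof
  have "\<phi> ` (if c then N d else {0}) = (if c then Q d else {0})" for c d
    by (simp add: \<phi>_image)
  then have mem_cochains: "f \<in> cochains n p r Q \<longleftrightarrow>
      (\<forall>bs. f bs \<in> \<phi> ` (if length bs = n \<and> ones bs = p then N (r + p) else {0}))" for f
    by (simp add: cochains_def)
  show "(\<circ>) \<phi> ` cochains n p r N \<subseteq> cochains n p r Q"
  proof clarify
    fix f assume "f \<in> cochains n p r N"
    then have "(\<phi> \<circ> f) bs \<in> \<phi> ` (if length bs = n \<and> ones bs = p then N (r + p) else {0})" for bs
      unfolding cochains_def o_apply by blast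
    then show "\<phi> \<circ> f \<in> cochains n p r Q"
      unfolding mem_cochains by blast
  qed
  show "cochains n p r Q \<subseteq> (\<circ>) \<phi> ` cochains n p r N"
  proof
    fix f assume "f \<in> cochains n p r Q"
    then have "\<forall>bs. \<exists>a. a \<in> (if length bs = n \<and> ones bs = p then N (r + p) else {0}) \<and> f bs = \<phi> a"
      unfolding mem_cochains by blast
    then obtain g where "\<And>bs. g bs \<in> (if length bs = n \<and> ones bs = p then N (r + p) else {0})"
        "\<And>bs. f bs = \<phi> (g bs)"
      by metis
    then have "g \<in> cochains n p r N" "f = \<phi> \<circ> g" by (auto simp: cochains_def)
    then show "f \<in> (\<circ>) \<phi> ` cochains n p r N" by blast
  qed
qed

lemma comp_in_cochains: "f \<in> cochains n p r N \<Longrightarrow> \<phi> \<circ> f \<in> cochains n p r Q"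
  using cochains_image by blast

lemma comp_diff_cochains:
  assumes "f \<in> cochains n p r N" "g \<in> cochains n p r N"
  shows "\<phi> \<circ> (f - g) = (\<phi> \<circ> f) - (\<phi> \<circ> g)"
proof
  fix bs
  have "f bs \<in> N (r + p) \<and> g bs \<in> N (r + p)"
    using assms zero_mem by (auto simp: cochains_def split: if_splits)
  then show "(\<phi> \<circ> (f - g)) bs = ((\<phi> \<circ> f) - (\<phi> \<circ> g)) bs"
    using \<phi>_diff[of "f bs" "r + p" "g bs"] by simp
qed

lemma koszul_d_comp_hom:
  "f \<in> cochains (length vs) p r N \<Longrightarrow> koszul_d y vs (\<phi> \<circ> f) = \<phi> \<circ> koszul_d x vs f"
proof (induction vs arbitrary: f p r)
  case (Cons w vs)
  then obtain g h where gh: "f = join g h" "g \<in> cochains (length vs) p r N"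
      "h \<in> cochains (length vs) (p - 1) (r + 1) N"
    by (auto elim: cochains_SucE)
  have "\<phi> \<circ> (x w \<circ> g) = y w \<circ> (\<phi> \<circ> g)"
  proof
    fix bs
    have "g bs \<in> N (r + p)" using gh(2) zero_mem by (auto simp: cochains_def split: if_splits)
    then show "(\<phi> \<circ> (x w \<circ> g)) bs = (y w \<circ> (\<phi> \<circ> g)) bs" by (simp add: \<phi>_x)
  qed
  then have "\<phi> \<circ> ((x w \<circ> g) - koszul_d x vs h) = (y w \<circ> (\<phi> \<circ> g)) - koszul_d y vs (\<phi> \<circ> h)"
    using comp_diff_cochains[OF cochains_x[OF gh(2)], of "koszul_d x vs h" w] koszul_d_mem[OF gh(3)]
    by (simp only: Cons.IH[OF gh(3)] diff_add_cancel)
  then show ?case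
    using Cons.IH[OF gh(2)] unfolding gh(1)
    by (simp only: koszul_d.simps comp_join \<phi>_zero join_comp_Cons)
qed (simp add: fun_eq_iff)

lemma koszul_cocycles_image_subset:
  "(\<circ>) \<phi> ` koszul_cocycles x N vs p r \<subseteq> koszul_cocycles y Q vs p r"
  using cochains_image[of "length vs" p r] koszul_d_comp_hom[of _ vs p r]
  by (auto simp: koszul_cocycles_def fun_eq_iff)

lemma koszul_coboundaries_image:
  "(\<circ>) \<phi> ` koszul_coboundaries x N vs p r = koszul_coboundaries y Q vs p r"
  using koszul_d_comp_hom[of _ vs "p - 1" r]
  by (auto simp: koszul_coboundaries_def image_image simp flip: cochains_image)

lemma koszul_cocycles_kernel_subset: "koszul_cocycles x K vs p r \<subseteq> koszul_cocycles x N vs p r"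
  by (auto simp: koszul_cocycles_def cochains_kernel)

lemma koszul_cocycles_subset_image:
  assumes "koszul_acyclic x K vs (p + 1) r"
  shows "koszul_cocycles y Q vs p r \<subseteq> (\<circ>) \<phi> ` koszul_cocycles x N vs p r"
proof
  fix f assume f: "f \<in> koszul_cocycles y Q vs p r"
  then obtain g where g: "g \<in> cochains (length vs) p r N" "f = \<phi> \<circ> g"
    by (auto simp: koszul_cocycles_def simp flip: cochains_image)
  then have "koszul_d x vs g \<in> koszul_cocycles x K vs (p + 1) r"
    using f koszul_d_comp_hom koszul_d_mem by (auto simp: koszul_cocycles_def cochains_kernel)
  then obtain k where k: "k \<in> cochains (length vs) p r K" "koszul_d x vs g = koszul_d x vs k"
    using assms by (auto simp: koszul_acyclic_def koszul_coboundaries_def)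
  then have "g - k \<in> koszul_cocycles x N vs p r" "\<phi> \<circ> (g - k) = f"
    using g comp_diff_cochains cochains_diff
    by (auto simp: koszul_cocycles_def koszul_d_diff cochains_kernel)
  then show "f \<in> (\<circ>) \<phi> ` koszul_cocycles x N vs p r" by blast
qed

text \<open>The part \<open>H\<^sup>p(N) \<rightarrow> H\<^sup>p(Q) \<rightarrow> H\<^sup>p\<^sup>+\<^sup>1(K) \<rightarrow> H\<^sup>p\<^sup>+\<^sup>1(N)\<close> of the long exact sequence, in the case
  where the last map vanishes.\<close>

lemma koszul_acyclic_kernel_iff:
  assumes null: "koszul_cocycles x K vs (p + 1) r \<subseteq> koszul_coboundaries x N vs (p + 1) r"
  shows "koszul_acyclic x K vs (p + 1) r \<longleftrightarrow>
    koszul_cocycles y Q vs p r \<subseteq> (\<circ>) \<phi> ` koszul_cocycles x N vs p r"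
proof
  assume lift: "koszul_cocycles y Q vs p r \<subseteq> (\<circ>) \<phi> ` koszul_cocycles x N vs p r"
  show "koszul_acyclic x K vs (p + 1) r"
    unfolding koszul_acyclic_def
  proof
    fix f assume f: "f \<in> koszul_cocycles x K vs (p + 1) r"
    then obtain g where g: "g \<in> cochains (length vs) p r N" "f = koszul_d x vs g"
      using null by (auto simp: koszul_coboundaries_def)
    then have "\<phi> \<circ> g \<in> koszul_cocycles y Q vs p r"
      using f koszul_d_comp_hom comp_in_cochains by (auto simp: koszul_cocycles_def cochains_kernel)
    then obtain g' where g': "g' \<in> koszul_cocycles x N vs p r" "\<phi> \<circ> g = \<phi> \<circ> g'"
      using lift by blast
    then have "g - g' \<in> cochains (length vs) p r K" "koszul_d x vs (g - g') = f"
      using g comp_diff_cochains cochains_diff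
      by (auto simp: koszul_cocycles_def koszul_d_diff cochains_kernel)
    then show "f \<in> koszul_coboundaries x K vs (p + 1) r"
      by (auto simp: koszul_coboundaries_def)
  qed
qed (rule koszul_cocycles_subset_image)

lemma koszul_acyclic_shift:
  assumes "koszul_cocycles x K vs (p + 1) r \<subseteq> koszul_coboundaries x N vs (p + 1) r"
    and "koszul_acyclic x N vs p r"
  shows "koszul_acyclic x K vs (p + 1) r \<longleftrightarrow> koszul_acyclic y Q vs p r"
  using koszul_acyclic_kernel_iff[OF assms(1)] assms(2) koszul_coboundaries_image[of vs p r]
  by (simp add: koszul_acyclic_iff_eq koszul_acyclic_def[of y])

lemma koszul_acyclic_kernel_1_iff:
  assumes "koszul_acyclic x N vs 1 r"
  shows "koszul_acyclic x K vs 1 r \<longleftrightarrow>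
    annihilated y Q (set vs) r \<subseteq> \<phi> ` annihilated x N (set vs) r"
proof -
  let ?bot = "single_cochain (replicate (length vs) False)"
  have "koszul_cocycles x K vs 1 r \<subseteq> koszul_coboundaries x N vs 1 r"
    using koszul_cocycles_kernel_subset assms unfolding koszul_acyclic_def by (rule subset_trans)
  then have "koszul_acyclic x K vs 1 r \<longleftrightarrow>
      koszul_cocycles y Q vs 0 r \<subseteq> (\<circ>) \<phi> ` koszul_cocycles x N vs 0 r"
    using koszul_acyclic_kernel_iff[of vs 0 r] by simp
  also have "(\<circ>) \<phi> ` koszul_cocycles x N vs 0 r = ?bot ` \<phi> ` annihilated x N (set vs) r"
    by (simp add: koszul_cocycles_0 image_image comp_single_cochain)
  finally show ?thesis
    by (simp add: cod.koszul_cocycles_0 inj_image_subset_iff inj_single_cochain)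
qed

lemma koszul_acyclic_iso:
  assumes "\<And>d. K d \<subseteq> {0}"
  shows "koszul_acyclic x N vs p r \<longleftrightarrow> koszul_acyclic y Q vs p r"
proof -
  have cochains_K: "cochains (length vs) p' r K \<subseteq> {0}" for p'
    using assms by (fastforce simp: cochains_def fun_eq_iff split: if_splits)
  then have cocycles_K: "koszul_cocycles x K vs p' r \<subseteq> {0}" for p'
    by (auto simp: koszul_cocycles_def)
  have inj: "inj_on ((\<circ>) \<phi>) (cochains (length vs) p r N)"
  proof (rule inj_onI)
    fix f g assume "f \<in> cochains (length vs) p r N" "g \<in> cochains (length vs) p r N" "\<phi> \<circ> f = \<phi> \<circ> g"
    then have "f - g \<in> cochains (length vs) p r K"
      by (simp add: cochains_kernel comp_diff_cochains cochains_diff)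
    then show "f = g" using cochains_K[of p] by fastforce
  qed
  have "koszul_acyclic x K vs (p + 1) r"
      "koszul_cocycles x K vs (p + 1) r \<subseteq> koszul_coboundaries x N vs (p + 1) r"
    using cocycles_K[of "p + 1"] ker.zero_in_koszul_coboundaries[of vs "p + 1" r]
      zero_in_koszul_coboundaries[of vs "p + 1" r]
    unfolding koszul_acyclic_def by blast+
  then have "koszul_cocycles y Q vs p r = (\<circ>) \<phi> ` koszul_cocycles x N vs p r"
    using koszul_acyclic_kernel_iff koszul_cocycles_image_subset by blast
  moreover have "koszul_cocycles x N vs p r \<subseteq> cochains (length vs) p r N"
    by (auto simp: koszul_cocycles_def)
  ultimately show ?thesis
    using inj_on_image_eq_iff[OF inj] koszul_coboundaries_subset_cocycles[of vs p r]
    by (simp add: koszul_acyclic_iff_eq cod.koszul_acyclic_iff_eq flip: koszul_coboundaries_image)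
qed

lemma multiples_image: "\<phi> ` multiples x N vs d = multiples y Q vs d"
proof (induction vs)
  case (Cons w vs)
  have "\<phi> (x w a + b) = y w (\<phi> a) + \<phi> b" if "a \<in> N (d - 1)" "b \<in> multiples x N vs d" for a b
    using that \<phi>_add[of "x w a" d b] \<phi>_x[of a "d - 1" w] x_mem[of a "d - 1" w] multiples_subset
    by auto
  then have "\<phi> ` multiples x N (w # vs) d =
      {y w (\<phi> a) + \<phi> b | a b. a \<in> N (d - 1) \<and> b \<in> multiples x N vs d}"
    by (auto simp: image_iff) metis
  also have "\<dots> = multiples y Q (w # vs) d"
    by (auto simp flip: Cons.IH \<phi>_image)
  finally show ?case .
qed simp

end

section \<open>Graded modules over the polynomial ring\<close>

definition tdeg :: "('n::finite \<Rightarrow>\<^sub>0 nat) \<Rightarrow> nat" where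
  "tdeg m = (\<Sum>i\<in>UNIV. Poly_Mapping.lookup m i)"

lemma tdeg_zero [simp]: "tdeg 0 = 0"
  by (simp add: tdeg_def)

lemma tdeg_add [simp]: "tdeg (m + m') = tdeg m + tdeg m'"
  by (simp add: tdeg_def lookup_add sum.distrib)

lemma tdeg_eq_0_iff: "tdeg m = 0 \<longleftrightarrow> m = 0"
  by (auto simp: tdeg_def poly_mapping_eq_iff fun_eq_iff)

definition unit_exp :: "'n \<Rightarrow> 'n \<Rightarrow>\<^sub>0 nat" where
  "unit_exp v = Poly_Mapping.single v 1"

lemma lookup_unit_exp: "Poly_Mapping.lookup (unit_exp v) w = of_bool (v = w)"
  by (simp add: unit_exp_def lookup_single when_def)

lemma keys_unit_exp [simp]: "Poly_Mapping.keys (unit_exp v) = {v}"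
  by (simp add: unit_exp_def)

lemma tdeg_unit_exp [simp]: "tdeg (unit_exp v) = 1"
  by (simp add: tdeg_def lookup_unit_exp)

lemma keys_add_nat [simp]:
  fixes m m' :: "'a \<Rightarrow>\<^sub>0 nat"
  shows "Poly_Mapping.keys (m + m') = Poly_Mapping.keys m \<union> Poly_Mapping.keys m'"
  by (auto simp: in_keys_iff lookup_add)

lemma unit_exp_add_diff:
  "v \<in> Poly_Mapping.keys m \<Longrightarrow> unit_exp v + (m - unit_exp v) = m"
  by (intro poly_mapping_eqI) (auto simp: in_keys_iff lookup_add lookup_minus lookup_unit_exp)

lemma add_diff_unit_exp:
  "v \<in> Poly_Mapping.keys m \<Longrightarrow> m' + m - unit_exp v = m' + (m - unit_exp v)"
  by (intro poly_mapping_eqI) (auto simp: in_keys_iff lookup_add lookup_minus lookup_unit_exp)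

lemma exponent_cases:
  fixes m :: "'n \<Rightarrow>\<^sub>0 nat"
  obtains "m = 0" | v m' where "m = unit_exp v + m'"
proof (cases "Poly_Mapping.keys m = {}")
  case True
  then show thesis using that(1) by simp
next
  case False
  then obtain v where "v \<in> Poly_Mapping.keys m" by blast
  then show thesis using that(2) unit_exp_add_diff by metis
qed

lemma exponent_induct [case_names zero step]:
  assumes "P 0" "\<And>v m. P m \<Longrightarrow> P (unit_exp v + m)"
  shows "P (m :: 'n::finite \<Rightarrow>\<^sub>0 nat)"
proof (induction "tdeg m" arbitrary: m rule: less_induct)
  case less
  show ?case by (cases m rule: exponent_cases) (use less assms in auto)
qed

abbreviation monomial :: "('n \<Rightarrow>\<^sub>0 nat) \<Rightarrow> ('n, 'k::zero_neq_one) mpoly" where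
  "monomial m \<equiv> Poly_Mapping.single m 1"

lemma var_eq_monomial: "var v = monomial (unit_exp v)"
  by (simp add: var_def unit_exp_def)

lemma var_mult_single: "var v * Poly_Mapping.single m c = Poly_Mapping.single (unit_exp v + m) c"
  by (simp add: var_eq_monomial mult_single)

lemma mpoly_eq_sum_single:
  "p = (\<Sum>m\<in>Poly_Mapping.keys p. Poly_Mapping.single m (Poly_Mapping.lookup p m))"
  by (rule poly_mapping_eqI) (auto simp: lookup_sum lookup_single when_def in_keys_iff)

lemma keys_var_mult:
  fixes p :: "('n::finite, 'k::field) mpoly"
  shows "Poly_Mapping.keys (var v * p) = (+) (unit_exp v) ` Poly_Mapping.keys p"
proof
  show "Poly_Mapping.keys (var v * p) \<subseteq> (+) (unit_exp v) ` Poly_Mapping.keys p"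
    using keys_mult[of "var v" p] by (auto simp: var_eq_monomial)
  have "var v * p =
      (\<Sum>m\<in>Poly_Mapping.keys p. Poly_Mapping.single (unit_exp v + m) (Poly_Mapping.lookup p m))"
    by (subst mpoly_eq_sum_single[of p]) (simp add: sum_distrib_left var_mult_single)
  then have "Poly_Mapping.lookup (var v * p) (unit_exp v + m) = Poly_Mapping.lookup p m" for m
    by (auto simp: lookup_sum lookup_single when_def in_keys_iff)
  then show "(+) (unit_exp v) ` Poly_Mapping.keys p \<subseteq> Poly_Mapping.keys (var v * p)"
    by (auto simp: in_keys_iff)
qed

interpretation mpoly: module "(*) :: ('n::finite, 'k::field) mpoly \<Rightarrow> _"
  by standard (auto simp: algebra_simps)

lemma subspace_tdeg_ge:
  "mpoly.subspace {p :: ('n::finite, 'k::field) mpoly. \<forall>m\<in>Poly_Mapping.keys p. l \<le> tdeg m}"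
    (is "mpoly.subspace ?S")
proof (rule mpoly.subspaceI)
  fix p q :: "('n, 'k) mpoly"
  show "p \<in> ?S \<Longrightarrow> q \<in> ?S \<Longrightarrow> p + q \<in> ?S" using Poly_Mapping.keys_add[of p q] by blast
  show "p \<in> ?S \<Longrightarrow> q * p \<in> ?S" using keys_mult[of q p] by (force intro: trans_le_add2)
qed simp

lemma mem_subspaceI_single:
  fixes p :: "('n::finite, 'k::field) mpoly"
  assumes "mpoly.subspace S" "\<And>m c. m \<in> Poly_Mapping.keys p \<Longrightarrow> Poly_Mapping.single m c \<in> S"
  shows "p \<in> S"
  using assms by (subst mpoly_eq_sum_single) (auto intro: mpoly.subspace_sum)

lemma irrelevant_ideal_eq:
  "(irrelevant_ideal :: ('n::finite, 'k::field) mpoly set) =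
     {p. \<forall>m\<in>Poly_Mapping.keys p. 1 \<le> tdeg m}"
proof
  show "irrelevant_ideal \<subseteq> {p :: ('n, 'k) mpoly. \<forall>m\<in>Poly_Mapping.keys p. 1 \<le> tdeg m}"
    unfolding irrelevant_ideal_def
    by (rule mpoly.span_minimal[OF _ subspace_tdeg_ge]) (auto simp: var_eq_monomial)
  show "{p :: ('n, 'k) mpoly. \<forall>m\<in>Poly_Mapping.keys p. 1 \<le> tdeg m} \<subseteq> irrelevant_ideal"
  proof
    fix p :: "('n, 'k) mpoly" assume p: "p \<in> {p. \<forall>m\<in>Poly_Mapping.keys p. 1 \<le> tdeg m}"
    show "p \<in> irrelevant_ideal"
      unfolding irrelevant_ideal_def
    proof (rule mem_subspaceI_single[OF mpoly.subspace_span])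
      fix m c assume "m \<in> Poly_Mapping.keys p"
      then have "1 \<le> tdeg m" using p by blast
      then obtain v m' where "m = unit_exp v + m'" by (cases m rule: exponent_cases) auto
      then have "Poly_Mapping.single m c = Poly_Mapping.single m' c * (var v :: ('n, 'k) mpoly)"
        by (simp add: mult.commute flip: var_mult_single)
      then show "Poly_Mapping.single m c \<in> mpoly.span (range (var :: 'n \<Rightarrow> ('n, 'k) mpoly))"
        by (simp add: mpoly.span_base mpoly.span_scale)
    qed
  qed
qed

lemma ideal_power_irrelevant_ideal_eq:
  "ideal_power (irrelevant_ideal :: ('n::finite, 'k::field) mpoly set) l =
     {p. \<forall>m\<in>Poly_Mapping.keys p. l \<le> tdeg m}"
proof (induction l)
  case (Suc l)
  let ?products = "{p * q | p q :: ('n, 'k) mpoly.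
      p \<in> irrelevant_ideal \<and> q \<in> ideal_power irrelevant_ideal l}"
  have "Suc l \<le> tdeg m" if p: "p \<in> irrelevant_ideal" and q: "q \<in> ideal_power irrelevant_ideal l"
      and m: "m \<in> Poly_Mapping.keys (p * q)" for p q :: "('n, 'k) mpoly" and m
  proof -
    obtain a b where ab: "m = a + b" "a \<in> Poly_Mapping.keys p" "b \<in> Poly_Mapping.keys q"
      using m keys_mult[of p q] by blast
    have "1 \<le> tdeg a" using p ab(2) unfolding irrelevant_ideal_eq by blast
    moreover have "l \<le> tdeg b" using q ab(3) unfolding Suc by blast
    ultimately show ?thesis using ab(1) by simp
  qed
  then have "mpoly.span ?products \<subseteq> {p. \<forall>m\<in>Poly_Mapping.keys p. Suc l \<le> tdeg m}"
    by (intro mpoly.span_minimal[OF _ subspace_tdeg_ge]) blast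
  moreover have "p \<in> mpoly.span ?products" if p: "\<forall>m\<in>Poly_Mapping.keys p. Suc l \<le> tdeg m" for p
  proof (rule mem_subspaceI_single[OF mpoly.subspace_span])
    fix m c assume "m \<in> Poly_Mapping.keys p"
    then have m: "Suc l \<le> tdeg m" using p by blast
    then obtain v m' where m': "m = unit_exp v + m'" by (cases m rule: exponent_cases) auto
    then have "Poly_Mapping.single m c = var v * (Poly_Mapping.single m' c :: ('n, 'k) mpoly)"
      by (simp add: var_mult_single)
    moreover have "var v \<in> (irrelevant_ideal :: ('n, 'k) mpoly set)"
      by (simp add: irrelevant_ideal_eq var_eq_monomial)
    moreover have "Poly_Mapping.single m' c \<in> ideal_power irrelevant_ideal l"
      using m m' by (simp add: Suc)
    ultimately show "Poly_Mapping.single m c \<in> mpoly.span ?products"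
      by (blast intro: mpoly.span_base)
  qed
  ultimately show ?case by auto
qed simp

lemma homogeneous_eq: "homogeneous e = {p. \<forall>m\<in>Poly_Mapping.keys p. tdeg m = e}"
  by (simp add: homogeneous_def tdeg_def)

abbreviation var_scale :: "(('n::finite, 'k::field) mpoly \<Rightarrow> 'm \<Rightarrow> 'm) \<Rightarrow> 'n \<Rightarrow> 'm \<Rightarrow> 'm" where
  "var_scale s \<equiv> \<lambda>v. s (var v)"

locale graded_mod =
  fixes s :: "('n::finite, 'k::field) mpoly \<Rightarrow> 'm::ab_group_add \<Rightarrow> 'm" and G :: "int \<Rightarrow> 'm set"
  assumes graded: "graded_module s G"
begin

sublocale module s
  using graded by (simp add: graded_module_def)

lemma homogeneous_scale_mem: "p \<in> homogeneous e \<Longrightarrow> a \<in> G d \<Longrightarrow> s p a \<in> G (d + int e)"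
  using graded by (simp add: graded_module_def)

sublocale koszul_module "var_scale s" G
proof
  fix d a v assume "a \<in> G d"
  then show "s (var v) a \<in> G (d + 1)"
    using homogeneous_scale_mem[of "var v" 1] by (simp add: homogeneous_eq var_eq_monomial)
qed (use graded in \<open>auto simp: graded_module_def scale_right_distrib mult.commute\<close>)

lemma single_scale_mem: "a \<in> G d \<Longrightarrow> s (Poly_Mapping.single m c) a \<in> G (d + int (tdeg m))"
  by (rule homogeneous_scale_mem) (simp_all add: homogeneous_eq)

lemma components_eq_0:
  "finite D \<Longrightarrow> (\<And>d. d \<in> D \<Longrightarrow> c d \<in> G d) \<Longrightarrow> sum c D = 0 \<Longrightarrow> d \<in> D \<Longrightarrow> c d = 0"
  using graded unfolding graded_module_def by blast

lemma sum_eq_homogeneous_part: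
  assumes "finite J" and t: "\<And>j. j \<in> J \<Longrightarrow> t j \<in> G (dg j)" and sum: "sum t J \<in> G d"
  shows "sum t J = sum t {j \<in> J. dg j = d}"
proof -
  let ?part = "\<lambda>d'. sum t {j \<in> J. dg j = d'}"
  let ?c = "\<lambda>d'. ?part d' - (if d' = d then sum t J else 0)"
  let ?D = "insert d (dg ` J)"
  have "sum ?part ?D = sum t J"
    using \<open>finite J\<close> by (intro sum.group) auto
  then have "sum ?c ?D = 0"
    using \<open>finite J\<close> by (simp add: sum_subtractf sum.delta del: sum.insert)
  moreover have "?part d' \<in> G d'" for d'
    using t by (intro sum_mem) auto
  then have "?c d' \<in> G d'" for d'
    using sum diff_mem by auto
  ultimately have "?c d = 0"
    using \<open>finite J\<close> components_eq_0[of ?D ?c d] by blast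
  then show ?thesis by simp
qed

lemma gcarrierE:
  assumes "a \<in> gcarrier G"
  obtains D c where "finite D" "\<And>d. c d \<in> G d" "\<And>d. d \<notin> D \<Longrightarrow> c d = 0" "a = sum c D"
proof -
  obtain D f where f: "finite D" "\<forall>d\<in>D. f d \<in> G d" "a = sum f D"
    using assms by (auto simp: gcarrier_def)
  then show thesis
    using zero_mem by (intro that[of D "\<lambda>d. if d \<in> D then f d else 0"]) auto
qed

lemma mem_gcarrier: "a \<in> G d \<Longrightarrow> a \<in> gcarrier G"
  unfolding gcarrier_def by (intro CollectI exI[of _ "{d}"] exI[of _ "\<lambda>_. a"]) auto

lemma gcarrier_add:
  assumes "a \<in> gcarrier G" "b \<in> gcarrier G"
  shows "a + b \<in> gcarrier G"
proof -
  obtain D c where c: "finite D" "\<And>d. c d \<in> G d" "\<And>d. d \<notin> D \<Longrightarrow> c d = 0" "a = sum c D"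
    using assms(1) by (rule gcarrierE) blast
  obtain D' c' where c': "finite D'" "\<And>d. c' d \<in> G d" "\<And>d. d \<notin> D' \<Longrightarrow> c' d = 0" "b = sum c' D'"
    using assms(2) by (rule gcarrierE) blast
  have "a = sum c (D \<union> D')" "b = sum c' (D \<union> D')"
    using c c' by (auto intro!: sum.mono_neutral_left)
  then have "a + b = (\<Sum>d\<in>D \<union> D'. c d + c' d)" by (simp add: sum.distrib)
  then show ?thesis
    using c(1,2) c'(1,2) add_mem unfolding gcarrier_def by blast
qed

end

locale graded_mod_hom = dom: graded_mod s G + cod: graded_mod s' G'
  for s :: "('n::finite, 'k::field) mpoly \<Rightarrow> 'a::ab_group_add \<Rightarrow> 'a" and G :: "int \<Rightarrow> 'a set"
    and s' :: "('n, 'k) mpoly \<Rightarrow> 'b::ab_group_add \<Rightarrow> 'b" and G' :: "int \<Rightarrow> 'b set" +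
  fixes f :: "'a \<Rightarrow> 'b"
  assumes hom: "graded_hom s G s' G' f"
begin

lemma hom_mem: "a \<in> G d \<Longrightarrow> f a \<in> G' d"
  using hom unfolding graded_hom_def by blast

lemma hom_add_gcarrier: "a \<in> gcarrier G \<Longrightarrow> b \<in> gcarrier G \<Longrightarrow> f (a + b) = f a + f b"
  using hom unfolding graded_hom_def by blast

lemma hom_add: "a \<in> G d \<Longrightarrow> b \<in> G d \<Longrightarrow> f (a + b) = f a + f b"
  using hom_add_gcarrier dom.mem_gcarrier by blast

lemma hom_zero [simp]: "f 0 = 0"
  using hom_add[OF dom.zero_mem dom.zero_mem] by simp

lemma hom_diff: "a \<in> G d \<Longrightarrow> b \<in> G d \<Longrightarrow> f (a - b) = f a - f b"
  using hom_add[OF dom.diff_mem, of a d b b] by simp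

lemma hom_scale: "a \<in> G d \<Longrightarrow> f (s p a) = s' p (f a)"
  using hom dom.mem_gcarrier unfolding graded_hom_def by blast

lemma hom_sum:
  assumes "\<And>d. c d \<in> G d" "finite D"
  shows "f (sum c D) = (\<Sum>d\<in>D. f (c d))"
proof -
  have "sum c D \<in> gcarrier G \<and> f (sum c D) = (\<Sum>d\<in>D. f (c d))"
    using assms(2)
  proof (induction D rule: finite_induct)
    case empty
    then show ?case using dom.mem_gcarrier[OF dom.zero_mem] by simp
  next
    case (insert d D)
    then show ?case
      using dom.gcarrier_add dom.mem_gcarrier[OF assms(1)] hom_add_gcarrier by simp
  qed
  then show ?thesis ..
qed

lemma image_gcarrier_Int: "f ` gcarrier G \<inter> G' d = f ` G d"
proof
  show "f ` G d \<subseteq> f ` gcarrier G \<inter> G' d"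
    using hom_mem dom.mem_gcarrier by blast
  show "f ` gcarrier G \<inter> G' d \<subseteq> f ` G d"
  proof clarify
    fix a assume a: "a \<in> gcarrier G" "f a \<in> G' d"
    obtain D c where c: "finite D" "\<And>d. c d \<in> G d" "a = sum c D"
      using a(1) by (rule dom.gcarrierE) blast
    then have "f a = (\<Sum>d'\<in>{d' \<in> D. d' = d}. f (c d'))"
      using a(2) hom_mem cod.sum_eq_homogeneous_part[of D "\<lambda>d. f (c d)" "\<lambda>d. d" d]
      by (simp add: hom_sum)
    also have "\<dots> = f (if d \<in> D then c d else 0)"
      by (cases "d \<in> D") (auto simp: Collect_conv_if)
    finally show "f a \<in> f ` G d" using c(2) dom.zero_mem by auto
  qed
qed

lemma koszul_short_exactI:
  assumes image: "\<And>d. f ` G d = Q d" and kernel: "\<And>d. {a \<in> G d. f a = 0} = K d"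
  shows "koszul_short_exact (var_scale s) G (var_scale s') Q f K"
proof
  fix a b :: 'b and d v
  show "s' (var u) (s' (var v) a) = s' (var v) (s' (var u) a)" for u by (rule cod.x_comm)
  show "0 \<in> Q d" using dom.zero_mem[of d] hom_zero by (metis image imageI)
  show "a \<in> Q d \<Longrightarrow> b \<in> Q d \<Longrightarrow> a - b \<in> Q d"
    unfolding image[symmetric] using dom.diff_mem by (force simp flip: hom_diff)
  show "a \<in> Q d \<Longrightarrow> s' (var v) a \<in> Q (d + 1)"
    unfolding image[symmetric] using dom.x_mem by (force simp flip: hom_scale)
qed (auto simp: cod.x_add hom_add hom_scale image simp flip: kernel)

end

section \<open>Free resolutions\<close>

locale free_graded = graded_mod s F
  for s :: "('n::finite, 'k::field) mpoly \<Rightarrow> 'f::ab_group_add \<Rightarrow> 'f" and F :: "int \<Rightarrow> 'f set" +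
  fixes B :: "'f set"
  assumes basis: "homogeneous_basis s F B"
begin

lemma finite_basis: "finite B"
  and homogeneous_basis: "B \<subseteq> (\<Union>r. F r)"
  and independent_basis: "independent B"
  and span_basis: "span B = gcarrier F"
  using basis by (auto simp: homogeneous_basis_def)

lemma mem_span_basis: "a \<in> F d \<Longrightarrow> a \<in> span B"
  by (simp add: span_basis mem_gcarrier)

lemma monomial_expansion:
  assumes "e \<in> span B"
  shows "e = (\<Sum>(b, m)\<in>(SIGMA b:B. Poly_Mapping.keys (representation B e b)).
    s (Poly_Mapping.single m (Poly_Mapping.lookup (representation B e b) m)) b)"
proof -
  have "e = (\<Sum>b\<in>B. s (representation B e b) b)"
    using sum_representation_eq[OF independent_basis assms finite_basis order_refl] by simp
  also have "\<dots> = (\<Sum>b\<in>B. \<Sum>m\<in>Poly_Mapping.keys (representation B e b).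
      s (Poly_Mapping.single m (Poly_Mapping.lookup (representation B e b) m)) b)"
    by (subst mpoly_eq_sum_single) (simp add: scale_sum_left)
  finally show ?thesis
    using finite_basis by (simp add: sum.Sigma)
qed

lemma keys_representation_homogeneous:
  assumes e: "e \<in> F d" and m: "m \<in> Poly_Mapping.keys (representation B e b)"
  shows "b \<in> B" "b \<in> F (d - int (tdeg m))"
proof -
  let ?r = "representation B e"
  let ?term = "\<lambda>b m. Poly_Mapping.single m (Poly_Mapping.lookup (?r b) m)"
  obtain dg where dg: "\<And>b. b \<in> B \<Longrightarrow> b \<in> F (dg b)"
    using homogeneous_basis by (metis UN_iff subsetD)
  define part where "part b =
      (\<Sum>m\<in>{m \<in> Poly_Mapping.keys (?r b). dg b + int (tdeg m) = d}. ?term b m)" for b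
  let ?J = "SIGMA b:B. Poly_Mapping.keys (?r b)"
  let ?t = "\<lambda>(b, m). s (?term b m) b" and ?deg = "\<lambda>(b, m). dg b + int (tdeg m)"
  have "e = sum ?t {j \<in> ?J. ?deg j = d}"
    using sum_eq_homogeneous_part[of ?J ?t ?deg d] monomial_expansion[OF mem_span_basis[OF e]] e dg
    by (force simp: finite_basis intro: single_scale_mem)
  also have "{j \<in> ?J. ?deg j = d} =
      (SIGMA b:B. {m \<in> Poly_Mapping.keys (?r b). dg b + int (tdeg m) = d})"
    by auto
  also have "sum ?t \<dots> = (\<Sum>b\<in>B. s (part b) b)"
    using finite_basis by (simp add: part_def scale_sum_left sum.Sigma)
  finally have "(\<Sum>b\<in>B. s (?r b - part b) b) = 0"
    using sum_representation_eq[OF independent_basis mem_span_basis[OF e] finite_basis order_refl]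
    by (simp add: scale_left_diff_distrib sum_subtractf)
  moreover have "?r b \<noteq> 0" using m by auto
  then show "b \<in> B" by (rule representation_ne_zero)
  ultimately have "?r b = part b"
    using independentD[OF independent_basis finite_basis order_refl] by fastforce
  moreover have "Poly_Mapping.keys (part b) \<subseteq> {m. dg b + int (tdeg m) = d}"
    unfolding part_def by (rule order_trans[OF keys_sum]) auto
  ultimately have "dg b + int (tdeg m) = d" using m by auto
  then show "b \<in> F (d - int (tdeg m))" using dg[OF \<open>b \<in> B\<close>] by auto
qed

lemma keys_representation_multiples:
  assumes "e \<in> multiples (var_scale s) F vs d" "m \<in> Poly_Mapping.keys (representation B e b)"
  shows "Poly_Mapping.keys m \<inter> set vs \<noteq> {}"
  using assms
proof (induction vs arbitrary: e)
  case Nil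
  then show ?case by (simp add: representation_zero)
next
  case (Cons w vs)
  then obtain a c where ac: "e = s (var w) a + c" "a \<in> F (d - 1)"
      and c: "c \<in> multiples (var_scale s) F vs d"
    by auto
  have "c \<in> span B" using c multiples_subset mem_span_basis by blast
  then have "representation B e b = var w * representation B a b + representation B c b"
    using ac(1) mem_span_basis[OF ac(2)]
    by (simp add: representation_add representation_scale independent_basis span_scale)
  then have "m \<in> (+) (unit_exp w) ` Poly_Mapping.keys (representation B a b) \<union>
      Poly_Mapping.keys (representation B c b)"
    using Cons.prems(2) Poly_Mapping.keys_add by (metis keys_var_mult subsetD)
  then show ?case using Cons.IH[OF c] by auto
qed

lemma mem_multiples_iff:
  assumes e: "e \<in> F d"
  shows "e \<in> multiples (var_scale s) F vs d \<longleftrightarrow>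
    (\<forall>b. \<forall>m\<in>Poly_Mapping.keys (representation B e b). Poly_Mapping.keys m \<inter> set vs \<noteq> {})"
proof
  assume supp: "\<forall>b. \<forall>m\<in>Poly_Mapping.keys (representation B e b). Poly_Mapping.keys m \<inter> set vs \<noteq> {}"
  have "s (Poly_Mapping.single m c) b \<in> multiples (var_scale s) F vs d"
    if m: "m \<in> Poly_Mapping.keys (representation B e b)" for b m c
  proof -
    obtain v where v: "v \<in> set vs" "v \<in> Poly_Mapping.keys m" using supp m by blast
    define m' where "m' = m - unit_exp v"
    have m': "m = unit_exp v + m'" using v(2) by (simp add: m'_def unit_exp_add_diff)
    have "s (Poly_Mapping.single m' c) b \<in> F (d - 1)"
      using single_scale_mem[OF keys_representation_homogeneous(2)[OF e m], of m' c]
      by (simp add: m')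
    then show ?thesis
      using x_in_multiples[OF v(1)] by (metis m' scale_scale var_mult_single)
  qed
  then show "e \<in> multiples (var_scale s) F vs d"
    by (subst monomial_expansion[OF mem_span_basis[OF e]]) (auto intro!: multiples_sum)
qed (use keys_representation_multiples in blast)

lemma regular_free: "distinct vs \<Longrightarrow> regular (var_scale s) F vs"
proof (induction vs)
  case (Cons w vs)
  have "e \<in> multiples (var_scale s) F vs d"
    if e: "e \<in> F d" "s (var w) e \<in> multiples (var_scale s) F vs (d + 1)" for e d
  proof -
    have "Poly_Mapping.keys (representation B (s (var w) e) b) =
        (+) (unit_exp w) ` Poly_Mapping.keys (representation B e b)" for b
      using mem_span_basis[OF e(1)]
      by (simp add: representation_scale independent_basis keys_var_mult)
    then have "Poly_Mapping.keys (unit_exp w + m) \<inter> set vs \<noteq> {}"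
      if "m \<in> Poly_Mapping.keys (representation B e b)" for b m
      using that e(2) unfolding mem_multiples_iff[OF x_mem[OF e(1)]] by blast
    then show ?thesis
      using Cons.prems unfolding mem_multiples_iff[OF e(1)] by simp
  qed
  then show ?case using Cons by simp
qed simp

lemma representation_in_irrelevant_ideal:
  assumes "e \<in> span {s p a | p a. p \<in> irrelevant_ideal \<and> a \<in> gcarrier F}"
  shows "representation B e b \<in> irrelevant_ideal"
proof -
  have "e \<in> span B \<and> representation B e b \<in> mpoly.span (range var)"
    using assms
  proof (induction rule: span_induct_alt)
    case base
    then show ?case by (simp add: span_zero representation_zero mpoly.span_zero)
  next
    case (step c z y)
    then obtain p a where z: "z = s p a" "p \<in> mpoly.span (range var)" "a \<in> span B"
      unfolding span_basis irrelevant_ideal_def by blast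
    then have "s c z \<in> span B" by (simp only: span_scale)
    moreover have "representation B (s c z) b = c * (p * representation B a b)"
      using z(3) by (simp only: z(1) representation_scale[OF independent_basis] span_scale)
    then have "representation B (s c z) b = (c * representation B a b) * p"
      by (simp only: mult_ac)
    then have "representation B (s c z) b \<in> mpoly.span (range var)"
      using z(2) by (simp only: mpoly.span_scale)
    ultimately show ?case
      using step.IH
      by (simp only: representation_add[OF independent_basis] span_add mpoly.span_add simp_thms)
  qed
  then show ?thesis by (simp add: irrelevant_ideal_def)
qed

lemma irrelevant_multiples_subset:
  assumes "set vs = UNIV"
  shows "F d \<inter> span {s p a | p a. p \<in> irrelevant_ideal \<and> a \<in> gcarrier F} \<subseteq>
    multiples (var_scale s) F vs d"
proof
  fix e assume e: "e \<in> F d \<inter> span {s p a | p a. p \<in> irrelevant_ideal \<and> a \<in> gcarrier F}"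
  have "Poly_Mapping.keys m \<inter> set vs \<noteq> {}" if "m \<in> Poly_Mapping.keys (representation B e b)" for b m
  proof -
    have "1 \<le> tdeg m"
      using representation_in_irrelevant_ideal e that by (auto simp: irrelevant_ideal_eq)
    then show ?thesis
      using assms by (cases m rule: exponent_cases) auto
  qed
  then show "e \<in> multiples (var_scale s) F vs d"
    using e mem_multiples_iff by blast
qed

lemma subset_multiples_iff_no_generator:
  assumes "set vs = UNIV"
  shows "F d \<subseteq> multiples (var_scale s) F vs d \<longleftrightarrow> B \<inter> F d = {}"
proof
  assume F: "F d \<subseteq> multiples (var_scale s) F vs d"
  have False if b: "b \<in> B" "b \<in> F d" for b
  proof -
    have "0 \<in> Poly_Mapping.keys (representation B b b)"
      using b(1) independent_basis by (simp add: representation_basis)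
    then show False using F b(2) mem_multiples_iff by fastforce
  qed
  then show "B \<inter> F d = {}" by blast
next
  assume B: "B \<inter> F d = {}"
  show "F d \<subseteq> multiples (var_scale s) F vs d"
  proof
    fix e assume e: "e \<in> F d"
    have "Poly_Mapping.keys m \<inter> set vs \<noteq> {}"
      if m: "m \<in> Poly_Mapping.keys (representation B e b)" for b m
    proof (cases m rule: exponent_cases)
      case 1
      then have "b \<in> F d" "b \<in> B"
        using keys_representation_homogeneous[OF e m] by auto
      then show ?thesis using B by blast
    qed (use assms in auto)
    then show "e \<in> multiples (var_scale s) F vs d" by (simp add: mem_multiples_iff[OF e])
  qed
qed

end

locale minimal_cover = free_graded s F B + koszul_short_exact "var_scale s" F y Q \<phi> K
  for s :: "('n::finite, 'k::field) mpoly \<Rightarrow> 'f::ab_group_add \<Rightarrow> 'f" and F B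
    and y :: "'n \<Rightarrow> 'b::ab_group_add \<Rightarrow> 'b" and Q \<phi> K +
  fixes vs :: "'n list"
  assumes distinct_vars: "distinct vs" and all_vars: "set vs = UNIV"
    and minimal: "K d \<subseteq> multiples (var_scale s) F vs d"
begin

lemma koszul_acyclic_syzygy:
  assumes "p < int (length vs)"
  shows "koszul_acyclic (var_scale s) K vs (p + 1) r \<longleftrightarrow> koszul_acyclic y Q vs p r"
proof (rule koszul_acyclic_shift)
  have acyclic: "koszul_acyclic (var_scale s) F vs p' r" if "p' < int (length vs)" for p'
    using koszul_acyclic_regular[OF regular_free[OF distinct_vars] that] .
  then show "koszul_acyclic (var_scale s) F vs p r" using assms .
  show "koszul_cocycles (var_scale s) K vs (p + 1) r \<subseteq>
      koszul_coboundaries (var_scale s) F vs (p + 1) r"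
  proof (cases "p + 1 = int (length vs)")
    case True
    then show ?thesis
      unfolding True ker.koszul_cocycles_top koszul_coboundaries_top
      by (intro image_mono minimal)
  next
    case False
    then show ?thesis
      using acyclic[of "p + 1"] assms koszul_cocycles_kernel_subset[of vs "p + 1" r]
      by (auto simp: koszul_acyclic_def)
  qed
qed

lemma koszul_acyclic_top_iff_no_generator:
  "koszul_acyclic y Q vs (int (length vs)) r \<longleftrightarrow> B \<inter> F (r + int (length vs)) = {}"
proof -
  let ?D = "r + int (length vs)" and ?mult = "multiples (var_scale s) F vs"
  have "koszul_acyclic y Q vs (int (length vs)) r \<longleftrightarrow> \<phi> ` F ?D \<subseteq> \<phi> ` ?mult ?D"
    by (simp add: cod.koszul_acyclic_top_iff \<phi>_image multiples_image)
  also have "\<dots> \<longleftrightarrow> F ?D \<subseteq> ?mult ?D"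
  proof
    assume sub: "\<phi> ` F ?D \<subseteq> \<phi> ` ?mult ?D"
    show "F ?D \<subseteq> ?mult ?D"
    proof
      fix e assume e: "e \<in> F ?D"
      then obtain e' where e': "e' \<in> ?mult ?D" "\<phi> e = \<phi> e'" using sub by blast
      then have "e - e' \<in> K ?D"
        using e multiples_subset[of vs ?D] \<phi>_diff[of e ?D e'] diff_mem[of e ?D e']
        by (auto simp: kernel)
      then show "e \<in> ?mult ?D" using multiples_add[of "e - e'" vs ?D e'] minimal e'(1) by auto
    qed
  qed (rule image_mono)
  also have "\<dots> \<longleftrightarrow> B \<inter> F ?D = {}" by (rule subset_multiples_iff_no_generator[OF all_vars])
  finally show ?thesis .
qed

end

locale minimal_free_resolution = M: graded_mod s M
  for s :: "('n::finite, 'k::field) mpoly \<Rightarrow> 'm::ab_group_add \<Rightarrow> 'm" and M :: "int \<Rightarrow> 'm set" +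
  fixes sF :: "('n, 'k) mpoly \<Rightarrow> 'f::ab_group_add \<Rightarrow> 'f" and F :: "nat \<Rightarrow> int \<Rightarrow> 'f set" and B \<epsilon> \<delta>
  assumes resolution: "minimal_graded_free_resolution s M sF F B \<epsilon> \<delta>"
begin

sublocale F: free_graded sF "F i" "B i" for i
  by unfold_locales (use resolution in \<open>auto simp: minimal_graded_free_resolution_def\<close>)

sublocale aug: graded_mod_hom sF "F 0" s M \<epsilon>
  by unfold_locales (use resolution in \<open>auto simp: minimal_graded_free_resolution_def\<close>)

sublocale diff: graded_mod_hom sF "F (Suc i)" sF "F i" "\<delta> i" for i
  by unfold_locales (use resolution in \<open>auto simp: minimal_graded_free_resolution_def\<close>)

definition syzygies :: "nat \<Rightarrow> int \<Rightarrow> 'f set" where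
  "syzygies i d = \<delta> i ` F (Suc i) d"

lemma syzygies_eq: "syzygies i d = \<delta> i ` gcarrier (F (Suc i)) \<inter> F i d"
  by (simp add: syzygies_def diff.image_gcarrier_Int)

lemma augmentation_image: "\<epsilon> ` F 0 d = M d"
  using aug.image_gcarrier_Int[of d] resolution M.mem_gcarrier
  by (auto simp: minimal_graded_free_resolution_def)

lemma augmentation_kernel: "{a \<in> F 0 d. \<epsilon> a = 0} = syzygies 0 d"
  using resolution F.mem_gcarrier by (auto simp: syzygies_eq minimal_graded_free_resolution_def)

lemma differential_kernel: "{a \<in> F (Suc i) d. \<delta> i a = 0} = syzygies (Suc i) d"
  using resolution F.mem_gcarrier by (auto simp: syzygies_eq minimal_graded_free_resolution_def)

lemma syzygies_subset_multiples:
  assumes "set vs = UNIV"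
  shows "syzygies i d \<subseteq> multiples (var_scale sF) (F i) vs d"
proof -
  have "\<delta> i ` gcarrier (F (Suc i)) \<subseteq>
      module.span sF {sF p a | p a. p \<in> irrelevant_ideal \<and> a \<in> gcarrier (F i)}"
    using resolution by (simp add: minimal_graded_free_resolution_def)
  then show ?thesis
    using F.irrelevant_multiples_subset[OF assms, of i d] by (auto simp: syzygies_eq)
qed

lemma minimal_cover_augmentation:
  assumes "distinct vs" "set vs = UNIV"
  shows "minimal_cover sF (F 0) (B 0) (var_scale s) M \<epsilon> (syzygies 0) vs"
proof -
  interpret koszul_short_exact "var_scale sF" "F 0" "var_scale s" M \<epsilon> "syzygies 0"
    by (rule aug.koszul_short_exactI[OF augmentation_image augmentation_kernel])
  show ?thesis
    by (intro minimal_cover.intro minimal_cover_axioms.intro F.free_graded_axioms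
        koszul_short_exact_axioms assms syzygies_subset_multiples)
qed

lemma minimal_cover_differential:
  assumes "distinct vs" "set vs = UNIV"
  shows "minimal_cover sF (F (Suc i)) (B (Suc i))
    (var_scale sF) (syzygies i) (\<delta> i) (syzygies (Suc i)) vs"
proof -
  interpret koszul_short_exact
    "var_scale sF" "F (Suc i)" "var_scale sF" "syzygies i" "\<delta> i" "syzygies (Suc i)"
    by (rule diff.koszul_short_exactI[OF syzygies_def[symmetric] differential_kernel])
  show ?thesis
    by (intro minimal_cover.intro minimal_cover_axioms.intro F.free_graded_axioms
        koszul_short_exact_axioms assms syzygies_subset_multiples)
qed

lemma koszul_acyclic_syzygies_iff_no_generator:
  assumes vars: "distinct vs" "set vs = UNIV"
  shows "koszul_acyclic (var_scale sF) (syzygies i) vs (int (length vs) - int k) r \<longleftrightarrow>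
    B (Suc (i + k)) \<inter> F (Suc (i + k)) (r + int (length vs)) = {}"
proof (induction k arbitrary: i)
  case 0
  show ?case
    using minimal_cover.koszul_acyclic_top_iff_no_generator[OF minimal_cover_differential[OF vars]]
    by simp
next
  case (Suc k)
  show ?case
    using Suc[of "Suc i"] minimal_cover.koszul_acyclic_syzygy
      [OF minimal_cover_differential[OF vars], of "int (length vs) - int (Suc k)" i r]
    by simp
qed

theorem koszul_acyclic_iff_no_generator:
  assumes vars: "distinct vs" "set vs = UNIV"
  shows "koszul_acyclic (var_scale s) M vs (int (length vs) - int j) r \<longleftrightarrow>
    B j \<inter> F j (r + int (length vs)) = {}"
proof (cases j)
  case 0
  then show ?thesis
    using minimal_cover.koszul_acyclic_top_iff_no_generator[OF minimal_cover_augmentation[OF vars]]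
    by simp
next
  case (Suc k)
  then show ?thesis
    using koszul_acyclic_syzygies_iff_no_generator[OF vars, of 0 k r]
      minimal_cover.koszul_acyclic_syzygy
        [OF minimal_cover_augmentation[OF vars], of "int (length vs) - int (Suc k)" r]
    by simp
qed

end

section \<open>Injective resolutions\<close>

definition monomial_ideal ::
  "('n::finite \<Rightarrow>\<^sub>0 nat) set \<Rightarrow> int \<Rightarrow> int \<Rightarrow> ('n, 'k::field) mpoly set" where
  "monomial_ideal U r d = {p. \<forall>m\<in>Poly_Mapping.keys p. m \<in> U \<and> r + int (tdeg m) = d}"

lemma monomial_ideal_mult:
  assumes up: "\<And>m m'. m \<in> U \<Longrightarrow> m' + m \<in> U"
    and "q \<in> homogeneous e" "p \<in> monomial_ideal U r d"
  shows "q * p \<in> monomial_ideal U r (d + int e)"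
proof -
  have "m \<in> U \<and> r + int (tdeg m) = d + int e" if m: "m \<in> Poly_Mapping.keys (q * p)" for m
  proof -
    obtain a b where "m = a + b" "a \<in> Poly_Mapping.keys q" "b \<in> Poly_Mapping.keys p"
      using m keys_mult[of q p] by blast
    then show ?thesis
      using assms by (auto simp: homogeneous_eq monomial_ideal_def)
  qed
  then show ?thesis by (simp add: monomial_ideal_def)
qed

lemma monomial_ideal_components_eq_0:
  assumes D: "finite D" "d \<in> D" and f: "\<forall>d\<in>D. f d \<in> monomial_ideal U r d" and sum: "sum f D = 0"
  shows "f d = 0"
proof -
  have "m \<notin> Poly_Mapping.keys (f d)" for m
  proof
    assume m: "m \<in> Poly_Mapping.keys (f d)"
    have "m \<notin> Poly_Mapping.keys (f d')" if "d' \<in> D - {d}" for d'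
    proof
      assume "m \<in> Poly_Mapping.keys (f d')"
      then have "r + int (tdeg m) = d'" "r + int (tdeg m) = d"
        using f D(2) m that unfolding monomial_ideal_def by blast+
      then show False using that by simp
    qed
    then have "(\<Sum>d'\<in>D. Poly_Mapping.lookup (f d') m) = Poly_Mapping.lookup (f d) m"
      using D by (simp add: sum.remove in_keys_iff)
    then show False using sum m by (metis in_keys_iff lookup_sum lookup_zero)
  qed
  then show ?thesis by (intro poly_mapping_eqI) (simp add: in_keys_iff)
qed

lemma graded_module_monomial_ideal:
  fixes U :: "('n::finite \<Rightarrow>\<^sub>0 nat) set"
  assumes up: "\<And>m m'. m \<in> U \<Longrightarrow> m' + m \<in> U"
  shows "graded_module (*) (monomial_ideal U r :: int \<Rightarrow> ('n, 'k::field) mpoly set)"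
  unfolding graded_module_def
proof (intro conjI allI ballI impI)
  show "module ((*) :: ('n, 'k) mpoly \<Rightarrow> _)" by (rule mpoly.module_axioms)
  fix d e and p q :: "('n, 'k) mpoly"
  show "0 \<in> (monomial_ideal U r d :: ('n, 'k) mpoly set)" by (simp add: monomial_ideal_def)
  show "p - q \<in> monomial_ideal U r d" if "p \<in> monomial_ideal U r d" "q \<in> monomial_ideal U r d"
  proof -
    have "Poly_Mapping.keys (p - q) \<subseteq> Poly_Mapping.keys p \<union> Poly_Mapping.keys q"
      by (auto simp: in_keys_iff lookup_minus)
    then show ?thesis using that unfolding monomial_ideal_def by blast
  qed
qed (rule monomial_ideal_mult[OF up] monomial_ideal_components_eq_0; assumption)+

text \<open>Values prescribed on the monomials in \<open>U\<close>, compatibly with multiplication by the variables,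
  amount to a homomorphism from the monomial ideal generated by \<open>U\<close>.\<close>

locale monomial_family = graded_mod s E
  for s :: "('n::finite, 'k::field) mpoly \<Rightarrow> 'e::ab_group_add \<Rightarrow> 'e" and E :: "int \<Rightarrow> 'e set" +
  fixes U :: "('n \<Rightarrow>\<^sub>0 nat) set" and w :: "('n \<Rightarrow>\<^sub>0 nat) \<Rightarrow> 'e" and r :: int
  assumes up: "m \<in> U \<Longrightarrow> unit_exp v + m \<in> U"
    and value_mem: "m \<in> U \<Longrightarrow> w m \<in> E (r + int (tdeg m))"
    and value_step: "m \<in> U \<Longrightarrow> w (unit_exp v + m) = s (var v) (w m)"
begin

lemma up_add: "m \<in> U \<Longrightarrow> m' + m \<in> U"
  by (induction m' rule: exponent_induct) (simp_all add: up add.assoc)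

lemma value_add: "m \<in> U \<Longrightarrow> w (m' + m) = s (monomial m') (w m)"
  by (induction m' rule: exponent_induct)
    (simp_all add: up_add value_step add.assoc flip: var_mult_single)

definition extension :: "('n, 'k) mpoly \<Rightarrow> 'e" where
  "extension p =
    (\<Sum>m\<in>Poly_Mapping.keys p. s (Poly_Mapping.single 0 (Poly_Mapping.lookup p m)) (w m))"

lemma extension_eq_sum:
  "finite X \<Longrightarrow> Poly_Mapping.keys p \<subseteq> X \<Longrightarrow>
   extension p = (\<Sum>m\<in>X. s (Poly_Mapping.single 0 (Poly_Mapping.lookup p m)) (w m))"
  unfolding extension_def by (intro sum.mono_neutral_left) (auto simp: in_keys_iff)

lemma extension_add: "extension (p + q) = extension p + extension q"
proof -
  let ?X = "Poly_Mapping.keys p \<union> Poly_Mapping.keys q"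
  have "extension (p + q) =
      (\<Sum>m\<in>?X. s (Poly_Mapping.single 0 (Poly_Mapping.lookup (p + q) m)) (w m))"
    using Poly_Mapping.keys_add[of p q] by (intro extension_eq_sum) auto
  then show ?thesis
    by (simp add: extension_eq_sum[of ?X] lookup_add single_add scale_left_distrib sum.distrib)
qed

lemma extension_sum: "extension (sum t J) = (\<Sum>j\<in>J. extension (t j))"
  by (induction J rule: infinite_finite_induct)
    (simp_all add: extension_add, simp_all add: extension_def)

lemma extension_single: "extension (Poly_Mapping.single m c) = s (Poly_Mapping.single 0 c) (w m)"
  using extension_eq_sum[of "{m}" "Poly_Mapping.single m c"] by simp

lemma extension_single_mult_single:
  "m \<in> U \<Longrightarrow> extension (Poly_Mapping.single m' c * Poly_Mapping.single m a) =
    s (Poly_Mapping.single m' c) (extension (Poly_Mapping.single m a))"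
  using value_add[of m m'] by (simp add: mult_single extension_single)

lemma extension_mult:
  assumes "Poly_Mapping.keys p \<subseteq> U"
  shows "extension (q * p) = s q (extension p)"
proof -
  let ?q = "\<lambda>m. Poly_Mapping.single m (Poly_Mapping.lookup q m)"
  let ?p = "\<lambda>m. Poly_Mapping.single m (Poly_Mapping.lookup p m)"
  have "q * p = (\<Sum>m'\<in>Poly_Mapping.keys q. \<Sum>m\<in>Poly_Mapping.keys p. ?q m' * ?p m)"
    using arg_cong2[OF mpoly_eq_sum_single[of q] mpoly_eq_sum_single[of p], of "(*)"]
    unfolding sum_product .
  then have "extension (q * p) =
      (\<Sum>m'\<in>Poly_Mapping.keys q. \<Sum>m\<in>Poly_Mapping.keys p. extension (?q m' * ?p m))"
    by (simp add: extension_sum)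
  also have "\<dots> = (\<Sum>m'\<in>Poly_Mapping.keys q. \<Sum>m\<in>Poly_Mapping.keys p. s (?q m') (extension (?p m)))"
    using assms by (intro sum.cong refl extension_single_mult_single) auto
  also have "\<dots> = (\<Sum>m'\<in>Poly_Mapping.keys q. s (?q m') (extension p))"
    using arg_cong[OF mpoly_eq_sum_single[of p], of extension]
    by (simp only: extension_sum flip: scale_sum_right)
  also have "\<dots> = s q (extension p)"
    using arg_cong[OF mpoly_eq_sum_single[of q], of "\<lambda>q. s q (extension p)"]
    by (simp only: scale_sum_left)
  finally show ?thesis .
qed

lemma keys_gcarrier_monomial_ideal:
  assumes "p \<in> gcarrier (monomial_ideal U r)"
  shows "Poly_Mapping.keys p \<subseteq> U"
proof -
  obtain D c where c: "\<forall>d\<in>D. c d \<in> monomial_ideal U r d" "p = sum c D"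
    using assms unfolding gcarrier_def by blast
  then have "\<forall>d\<in>D. Poly_Mapping.keys (c d) \<subseteq> U" unfolding monomial_ideal_def by blast
  then show ?thesis unfolding c(2) using Poly_Mapping.keys_sum[of c D] by blast
qed

lemma extension_mem:
  assumes "p \<in> monomial_ideal U r d"
  shows "extension p \<in> E d"
  unfolding extension_def
proof (rule sum_mem)
  fix m assume "m \<in> Poly_Mapping.keys p"
  then have m: "m \<in> U" "d = r + int (tdeg m)" using assms by (auto simp: monomial_ideal_def)
  show "s (Poly_Mapping.single 0 (Poly_Mapping.lookup p m)) (w m) \<in> E d"
    using single_scale_mem[OF value_mem[OF m(1)], of 0] by (simp add: m(2))
qed

lemma graded_hom_extension: "graded_hom (*) (monomial_ideal U r) s E extension"
  unfolding graded_hom_def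
  by (intro conjI allI ballI image_subsetI extension_add extension_mem extension_mult
      keys_gcarrier_monomial_ideal)

lemma graded_injective_extend:
  assumes "graded_injective s E"
  shows "\<exists>a\<in>E r. \<forall>m\<in>U. s (monomial m) a = w m"
proof -
  interpret U: graded_mod "(*)" "monomial_ideal U r :: int \<Rightarrow> ('n, 'k) mpoly set"
    by (rule graded_mod.intro[OF graded_module_monomial_ideal]) (rule up_add)
  interpret R: graded_mod "(*)" "monomial_ideal UNIV r :: int \<Rightarrow> ('n, 'k) mpoly set"
    by (rule graded_mod.intro[OF graded_module_monomial_ideal]) simp
  have "\<forall>d. monomial_ideal U r d \<subseteq> (monomial_ideal UNIV r d :: ('n, 'k) mpoly set)"
    by (auto simp: monomial_ideal_def)
  then obtain g where g: "graded_hom (*) (monomial_ideal UNIV r) s E g"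
      "\<forall>p\<in>gcarrier (monomial_ideal U r). g p = extension p"
    using assms U.graded R.graded graded_hom_extension unfolding graded_injective_def by blast
  interpret g: graded_mod_hom "(*)" "monomial_ideal UNIV r" s E g
    by unfold_locales (rule g(1))
  have one: "1 \<in> monomial_ideal UNIV r r" by (simp add: monomial_ideal_def)
  have "s (monomial m) (g 1) = w m" if "m \<in> U" for m
  proof -
    have "(monomial m :: ('n, 'k) mpoly) \<in> gcarrier (monomial_ideal U r)"
      using that U.mem_gcarrier[of "monomial m" "r + int (tdeg m)"]
      by (simp add: monomial_ideal_def)
    then have "g (monomial m) = w m" using g(2) by (simp add: extension_single)
    then show ?thesis using g.hom_scale[OF one, of "monomial m"] by simp
  qed
  then show ?thesis using g.hom_mem[OF one] by blast
qed

end

context graded_mod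
begin

lemma scale_annihilated_eq_0:
  assumes "Poly_Mapping.keys m \<inter> V \<noteq> {}" "a \<in> annihilated (var_scale s) G V d"
  shows "s (Poly_Mapping.single m c) a = 0"
proof -
  obtain v where v: "v \<in> V" "v \<in> Poly_Mapping.keys m" using assms(1) by blast
  have "Poly_Mapping.single m c = Poly_Mapping.single (m - unit_exp v) c * var v"
    using var_mult_single[of v "m - unit_exp v" c] v(2)
    by (simp add: unit_exp_add_diff mult.commute)
  then show ?thesis using v(1) assms(2) by (simp add: annihilated_def flip: scale_scale)
qed

text \<open>A preimage \<open>y\<close> of \<open>e\<close> under \<open>w\<close> that is killed by \<open>V\<close> solves the system \<open>m y = (m / w) e\<close> for
  the monomials \<open>m\<close> divisible by \<open>w\<close>, and \<open>m y = 0\<close> for the others divisible by a variable in \<open>V\<close>.\<close>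

lemma graded_injective_annihilated_subset_image:
  assumes inj: "graded_injective s G" and w: "w \<notin> V"
  shows "annihilated (var_scale s) G V d \<subseteq> s (var w) ` annihilated (var_scale s) G V (d - 1)"
proof
  fix e assume e: "e \<in> annihilated (var_scale s) G V d"
  define U where "U = {m :: 'n \<Rightarrow>\<^sub>0 nat. Poly_Mapping.keys m \<inter> insert w V \<noteq> {}}"
  define a where
    "a m = (if w \<in> Poly_Mapping.keys m then s (monomial (m - unit_exp w)) e else 0)" for m
  interpret monomial_family s G U a "d - 1"
  proof
    fix m v assume m: "m \<in> U"
    show "unit_exp v + m \<in> U" using m by (auto simp: U_def)
    show "a m \<in> G (d - 1 + int (tdeg m))"
    proof (cases "w \<in> Poly_Mapping.keys m")
      case True
      then have "tdeg m = Suc (tdeg (m - unit_exp w))"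
        using tdeg_add[of "unit_exp w" "m - unit_exp w"] by (simp add: unit_exp_add_diff)
      then show ?thesis
        using True e single_scale_mem[of e d "m - unit_exp w" 1]
        by (simp add: a_def annihilated_def)
    qed (simp add: a_def zero_mem)
    show "a (unit_exp v + m) = s (var v) (a m)"
    proof (cases "w \<in> Poly_Mapping.keys m")
      case True
      then show ?thesis by (simp add: a_def add_diff_unit_exp var_mult_single)
    next
      case False
      then have "Poly_Mapping.keys m \<inter> V \<noteq> {}" using m by (auto simp: U_def)
      then show ?thesis using False scale_annihilated_eq_0[OF _ e] by (simp add: a_def)
    qed
  qed
  obtain y where y: "y \<in> G (d - 1)" "\<And>m. m \<in> U \<Longrightarrow> s (monomial m) y = a m"
    using graded_injective_extend[OF inj] by blast
  have "s (var v) y = a (unit_exp v)" if "v \<in> insert w V" for v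
    using that y(2)[of "unit_exp v"] by (auto simp: var_eq_monomial U_def)
  then have "s (var w) y = e" "\<forall>v\<in>V. s (var v) y = 0" using w by (auto simp: a_def)
  then show "e \<in> s (var w) ` annihilated (var_scale s) G V (d - 1)"
    using y(1) by (auto simp: annihilated_def)
qed

lemma coregular_injective:
  assumes "graded_injective s G"
  shows "distinct vs \<Longrightarrow> coregular (var_scale s) G vs"
  by (induction vs) (simp_all add: graded_injective_annihilated_subset_image[OF assms])

end

locale injective_resolution = M: graded_mod s M
  for s :: "('n::finite, 'k::field) mpoly \<Rightarrow> 'm::ab_group_add \<Rightarrow> 'm" and M :: "int \<Rightarrow> 'm set" +
  fixes sI :: "('n, 'k) mpoly \<Rightarrow> 'e::ab_group_add \<Rightarrow> 'e" and I :: "nat \<Rightarrow> int \<Rightarrow> 'e set" and \<eta> dI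
  assumes resolution: "graded_injective_resolution s M sI I \<eta> dI"
begin

lemma injective: "graded_injective sI (I i)"
  using resolution by (simp add: graded_injective_resolution_def)

sublocale I: graded_mod sI "I i" for i
  by unfold_locales (use injective in \<open>simp add: graded_injective_def\<close>)

sublocale coaug: graded_mod_hom s M sI "I 0" \<eta>
  by unfold_locales (use resolution in \<open>simp add: graded_injective_resolution_def\<close>)

sublocale diff: graded_mod_hom sI "I i" sI "I (Suc i)" "dI i" for i
  by unfold_locales (use resolution in \<open>simp add: graded_injective_resolution_def\<close>)

definition cocycles :: "nat \<Rightarrow> int \<Rightarrow> 'e set" where
  "cocycles i d = {a \<in> I i d. dI i a = 0}"

lemma coaugmentation_image: "\<eta> ` M d = cocycles 0 d"
  using coaug.image_gcarrier_Int[of d] resolution I.mem_gcarrier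
  by (auto simp: cocycles_def graded_injective_resolution_def)

lemma coaugmentation_kernel: "{a \<in> M d. \<eta> a = 0} = {0}"
proof -
  have "a = 0" if "a \<in> M d" "\<eta> a = 0" for a
    using that resolution M.mem_gcarrier M.zero_mem coaug.hom_zero
    unfolding graded_injective_resolution_def by (metis inj_onD)
  then show ?thesis using M.zero_mem by auto
qed

lemma differential_image: "dI i ` I i d = cocycles (Suc i) d"
  using diff.image_gcarrier_Int[of i d] resolution I.mem_gcarrier
  by (auto simp: cocycles_def graded_injective_resolution_def)

lemma differential_differential: "a \<in> I i d \<Longrightarrow> dI (Suc i) (dI i a) = 0"
  using differential_image[of i d] by (auto simp: cocycles_def)

lemma koszul_acyclic_injective:
  "distinct vs \<Longrightarrow> p > 0 \<Longrightarrow> koszul_acyclic (var_scale sI) (I i) vs p r"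
  by (intro I.koszul_acyclic_coregular I.coregular_injective injective)

lemma koszul_short_exact_cocycles:
  "koszul_short_exact (var_scale sI) (I i) (var_scale sI) (cocycles (Suc i)) (dI i) (cocycles i)"
  by (rule diff.koszul_short_exactI[OF differential_image]) (simp add: cocycles_def)

lemma koszul_acyclic_cocycles_shift:
  assumes "distinct vs" "p > 0"
  shows "koszul_acyclic (var_scale sI) (cocycles i) vs (p + 1) r \<longleftrightarrow>
    koszul_acyclic (var_scale sI) (cocycles (Suc i)) vs p r"
proof -
  interpret koszul_short_exact
    "var_scale sI" "I i" "var_scale sI" "cocycles (Suc i)" "dI i" "cocycles i"
    by (rule koszul_short_exact_cocycles)
  show ?thesis
  proof (rule koszul_acyclic_shift)
    show "koszul_cocycles (var_scale sI) (cocycles i) vs (p + 1) r \<subseteq>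
        koszul_coboundaries (var_scale sI) (I i) vs (p + 1) r"
      using koszul_cocycles_kernel_subset[of vs "p + 1" r] assms(2)
        koszul_acyclic_injective[OF assms(1), of "p + 1" i r]
      by (auto simp: koszul_acyclic_def)
  qed (rule koszul_acyclic_injective[OF assms])
qed

lemma koszul_acyclic_cocycles_iff:
  assumes "distinct vs"
  shows "koszul_acyclic (var_scale sI) (cocycles i) vs (1 + int k) r \<longleftrightarrow>
    koszul_acyclic (var_scale sI) (cocycles (i + k)) vs 1 r"
proof (induction k arbitrary: i)
  case (Suc k)
  show ?case
    using koszul_acyclic_cocycles_shift[OF assms, of "1 + int k" i r] Suc[of "Suc i"]
    by (simp add: algebra_simps)
qed simp

abbreviation socle :: "nat \<Rightarrow> int \<Rightarrow> 'e set" where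
  "socle i \<equiv> annihilated (var_scale sI) (I i) UNIV"

text \<open>Exactness of the complex of socles is the vanishing of \<open>Ext\<^sup>i(k, M)\<^sub>r\<close>.\<close>

definition socle_exact :: "nat \<Rightarrow> int \<Rightarrow> bool" where
  "socle_exact i r \<longleftrightarrow> (\<forall>z\<in>socle i r. dI i z = 0 \<longrightarrow>
     (case i of 0 \<Rightarrow> z = 0 | Suc j \<Rightarrow> z \<in> dI j ` socle j r))"

theorem koszul_acyclic_iff_socle_exact:
  assumes vars: "distinct vs" "set vs = UNIV"
  shows "koszul_acyclic (var_scale s) M vs (int i) r \<longleftrightarrow> socle_exact i r"
proof -
  interpret coaug: koszul_short_exact "var_scale s" M "var_scale sI" "cocycles 0" \<eta> "\<lambda>_. {0}"
    by (rule coaug.koszul_short_exactI[OF coaugmentation_image coaugmentation_kernel])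
  have M: "koszul_acyclic (var_scale s) M vs (int i) r \<longleftrightarrow>
      koszul_acyclic (var_scale sI) (cocycles 0) vs (int i) r"
    by (rule coaug.koszul_acyclic_iso) simp
  show ?thesis
  proof (cases i)
    case 0
    then show ?thesis
      unfolding M
      by (auto simp: coaug.cod.koszul_acyclic_0_iff socle_exact_def annihilated_def
          cocycles_def vars)
  next
    case (Suc k)
    interpret koszul_short_exact
      "var_scale sI" "I k" "var_scale sI" "cocycles (Suc k)" "dI k" "cocycles k"
      by (rule koszul_short_exact_cocycles)
    have "koszul_acyclic (var_scale sI) (cocycles 0) vs (int i) r \<longleftrightarrow>
        koszul_acyclic (var_scale sI) (cocycles k) vs 1 r"
      using koszul_acyclic_cocycles_iff[OF vars(1), of 0 k r] Suc by simp
    also have "\<dots> \<longleftrightarrow> annihilated (var_scale sI) (cocycles (Suc k)) UNIV r \<subseteq> dI k ` socle k r"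
      using koszul_acyclic_kernel_1_iff[of vs r] vars(2)
        koszul_acyclic_injective[OF vars(1), of 1 k r]
      by simp
    also have "\<dots> \<longleftrightarrow> socle_exact i r"
      unfolding Suc socle_exact_def by (auto simp: annihilated_def cocycles_def)
    finally show ?thesis using M by simp
  qed
qed

end

section \<open>Local cohomology\<close>

definition killed_from ::
  "(('n::finite, 'k::field) mpoly \<Rightarrow> 'e::ab_group_add \<Rightarrow> 'e) \<Rightarrow> nat \<Rightarrow> 'e \<Rightarrow> bool" where
  "killed_from s l a \<longleftrightarrow> (\<forall>m. l \<le> tdeg m \<longrightarrow> s (monomial m) a = 0)"

lemma killed_from_mono: "killed_from s l a \<Longrightarrow> l \<le> l' \<Longrightarrow> killed_from s l' a"
  by (auto simp: killed_from_def)

lemma killed_from_iff_of_Suc: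
  "killed_from s (Suc l) a \<Longrightarrow> killed_from s l a \<longleftrightarrow> (\<forall>m. tdeg m = l \<longrightarrow> s (monomial m) a = 0)"
  unfolding killed_from_def by (metis Suc_leI le_neq_implies_less order_refl)

context graded_mod
begin

lemma killed_from_zero: "killed_from s l 0"
  by (simp add: killed_from_def)

lemma killed_from_diff: "killed_from s l a \<Longrightarrow> killed_from s l b \<Longrightarrow> killed_from s l (a - b)"
  by (simp add: killed_from_def scale_right_diff_distrib)

lemma killed_from_0_iff: "killed_from s 0 a \<longleftrightarrow> a = 0"
  unfolding killed_from_def using scale_one[of a] by (metis le0 scale_zero_right single_one)

lemma killed_from_Suc_iff:
  "killed_from s (Suc l) a \<longleftrightarrow> (\<forall>m. tdeg m = l \<longrightarrow> (\<forall>v. s (var v) (s (monomial m) a) = 0))"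
proof
  show "\<forall>m. tdeg m = l \<longrightarrow> (\<forall>v. s (var v) (s (monomial m) a) = 0)" if "killed_from s (Suc l) a"
    using that by (simp add: killed_from_def var_mult_single)
  assume killed: "\<forall>m. tdeg m = l \<longrightarrow> (\<forall>v. s (var v) (s (monomial m) a) = 0)"
  have "Suc l \<le> tdeg m \<Longrightarrow> s (monomial m) a = 0" for m
  proof (induction m rule: exponent_induct)
    case (step v m)
    have "s (monomial (unit_exp v + m)) a = s (var v) (s (monomial m) a)"
      by (simp add: var_mult_single)
    also have "\<dots> = 0"
      using step killed by (cases "tdeg m = l") auto
    finally show ?case .
  qed simp
  then show "killed_from s (Suc l) a" by (simp add: killed_from_def)
qed

lemma killed_by_ideal_power_iff:
  "(\<forall>p\<in>ideal_power irrelevant_ideal l. s p a = 0) \<longleftrightarrow> killed_from s l a"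
proof
  show "killed_from s l a" if "\<forall>p\<in>ideal_power irrelevant_ideal l. s p a = 0"
    using that by (simp add: ideal_power_irrelevant_ideal_eq killed_from_def)
  assume killed: "killed_from s l a"
  show "\<forall>p\<in>ideal_power irrelevant_ideal l. s p a = 0"
  proof
    fix p :: "('n, 'k) mpoly" assume p: "p \<in> ideal_power irrelevant_ideal l"
    have "s (Poly_Mapping.single m c) a = 0" if "m \<in> Poly_Mapping.keys p" for m c
    proof -
      have "s (monomial m) a = 0"
        using killed p that by (simp add: ideal_power_irrelevant_ideal_eq killed_from_def)
      then have "s (Poly_Mapping.single 0 c) (s (monomial m) a) = 0"
        by (simp only: scale_zero_right)
      then show ?thesis by (simp add: mult_single)
    qed
    then show "s p a = 0"
      by (subst mpoly_eq_sum_single) (simp add: scale_sum_left)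
  qed
qed

lemma torsion_part_irrelevant_ideal:
  "torsion_part irrelevant_ideal s G r = {a \<in> G r. \<exists>l. killed_from s l a}"
  by (simp add: torsion_part_def killed_by_ideal_power_iff)

end

lemma quotient_eq_singleton_iff:
  fixes Z B :: "'a::ab_group_add set"
  assumes B: "0 \<in> B" "\<And>x y. x \<in> B \<Longrightarrow> y \<in> B \<Longrightarrow> x - y \<in> B" and "B \<subseteq> Z"
  shows "Z // {(x, y). x \<in> Z \<and> y \<in> Z \<and> x - y \<in> B} = {B} \<longleftrightarrow> Z \<subseteq> B"
proof
  let ?R = "{(x, y). x \<in> Z \<and> y \<in> Z \<and> x - y \<in> B}"
  show "Z \<subseteq> B" if "Z // ?R = {B}"
  proof
    fix z assume z: "z \<in> Z"
    then have "?R `` {z} = B" using that quotientI[of z Z ?R] by blast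
    moreover have "z \<in> ?R `` {z}" using z B(1) by simp
    ultimately show "z \<in> B" by blast
  qed
  assume "Z \<subseteq> B"
  then have "Z = B" using \<open>B \<subseteq> Z\<close> by blast
  then have "?R `` {z} = B" if "z \<in> Z" for z using that B(2) by auto
  then have "Z // ?R = (\<lambda>_. B) ` Z" by (auto simp: quotient_def)
  then show "Z // ?R = {B}" using B(1) \<open>Z = B\<close> by auto
qed

definition cohomology_degrees ::
  "(('n::finite, 'k::field) mpoly \<Rightarrow> 'e::ab_group_add \<Rightarrow> 'e) \<Rightarrow> (nat \<Rightarrow> int \<Rightarrow> 'e set) \<Rightarrow>
   (nat \<Rightarrow> 'e \<Rightarrow> 'e) \<Rightarrow> nat \<Rightarrow> int set" where
  "cohomology_degrees sI I dI i = {r. local_cohomology sI I dI i r \<noteq> {lc_coboundaries sI I dI i r}}"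

context injective_resolution
begin

abbreviation torsion_cocycles :: "nat \<Rightarrow> int \<Rightarrow> 'e set" where
  "torsion_cocycles \<equiv> lc_cocycles sI I dI"

abbreviation torsion_coboundaries :: "nat \<Rightarrow> int \<Rightarrow> 'e set" where
  "torsion_coboundaries \<equiv> lc_coboundaries sI I dI"

lemma killed_from_differential: "a \<in> I i r \<Longrightarrow> killed_from sI l a \<Longrightarrow> killed_from sI l (dI i a)"
  by (simp add: killed_from_def flip: diff.hom_scale)

lemma torsion_cocycles_iff:
  "z \<in> torsion_cocycles i r \<longleftrightarrow> z \<in> I i r \<and> (\<exists>l. killed_from sI l z) \<and> dI i z = 0"
  by (auto simp: lc_cocycles_def I.torsion_part_irrelevant_ideal)

lemma torsion_coboundaries_0 [simp]: "torsion_coboundaries 0 r = {0}"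
  by (simp add: lc_coboundaries_def)

lemma torsion_coboundaries_Suc:
  "torsion_coboundaries (Suc j) r = dI j ` {y \<in> I j r. \<exists>l. killed_from sI l y}"
  by (simp add: lc_coboundaries_def I.torsion_part_irrelevant_ideal)

lemma zero_in_torsion_coboundaries: "0 \<in> torsion_coboundaries i r"
proof (cases i)
  case (Suc j)
  have "0 = dI j 0" by simp
  then show ?thesis
    unfolding Suc torsion_coboundaries_Suc using I.zero_mem I.killed_from_zero by blast
qed simp

lemma torsion_coboundaries_diff:
  assumes "a \<in> torsion_coboundaries i r" "b \<in> torsion_coboundaries i r"
  shows "a - b \<in> torsion_coboundaries i r"
proof (cases i)
  case (Suc j)
  then obtain y l y' l' where y: "a = dI j y" "y \<in> I j r" "killed_from sI l y"
      and y': "b = dI j y'" "y' \<in> I j r" "killed_from sI l' y'"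
    using assms by (auto simp: torsion_coboundaries_Suc)
  have "killed_from sI (max l l') (y - y')"
    using y(3) y'(3) by (intro I.killed_from_diff) (auto intro: killed_from_mono)
  moreover have "a - b = dI j (y - y')"
    using y y' by (simp add: diff.hom_diff[of y j r y'])
  ultimately show ?thesis
    using I.diff_mem[OF y(2) y'(2)] unfolding Suc torsion_coboundaries_Suc by blast
qed (use assms in simp)

lemma torsion_coboundaries_add:
  "a \<in> torsion_coboundaries i r \<Longrightarrow> b \<in> torsion_coboundaries i r \<Longrightarrow> a + b \<in> torsion_coboundaries i r"
  using torsion_coboundaries_diff[OF _ torsion_coboundaries_diff[OF zero_in_torsion_coboundaries]]
  by force

lemma torsion_coboundaries_subset: "torsion_coboundaries i r \<subseteq> torsion_cocycles i r"
proof (cases i)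
  case 0
  then show ?thesis using I.zero_mem I.killed_from_zero by (auto simp: torsion_cocycles_iff)
next
  case (Suc j)
  then show ?thesis
    using diff.hom_mem differential_differential killed_from_differential
    unfolding Suc torsion_coboundaries_Suc by (fastforce simp: torsion_cocycles_iff)
qed

lemma cohomology_degrees_iff:
  "r \<in> cohomology_degrees sI I dI i \<longleftrightarrow> \<not> torsion_cocycles i r \<subseteq> torsion_coboundaries i r"
  by (simp add: cohomology_degrees_def local_cohomology_def quotient_eq_singleton_iff
      zero_in_torsion_coboundaries torsion_coboundaries_diff torsion_coboundaries_subset)

lemma socle_iff: "z \<in> socle i r \<longleftrightarrow> z \<in> I i r \<and> killed_from sI 1 z"
  using I.killed_from_Suc_iff[of 0 z] by (auto simp: annihilated_def tdeg_eq_0_iff)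

lemma monomial_multiple_in_socle:
  assumes a: "a \<in> I i r" "killed_from sI (Suc l) a" and m: "tdeg m = l"
  shows "sI (monomial m) a \<in> socle i (r + int l)"
  using a m I.single_scale_mem[OF a(1), of m 1]
  by (simp add: annihilated_def I.killed_from_Suc_iff del: I.scale_scale)

lemma injective_socle_interpolation:
  assumes b: "\<And>m. tdeg m = l \<Longrightarrow> b m \<in> socle j (r + int l)"
  obtains y where "y \<in> I j r" "killed_from sI (Suc l) y"
    "\<And>m. tdeg m = l \<Longrightarrow> sI (monomial m) y = b m"
proof -
  interpret monomial_family sI "I j" "{m. l \<le> tdeg m}" "\<lambda>m. if tdeg m = l then b m else 0" r
    by unfold_locales (use b I.zero_mem in \<open>auto simp: annihilated_def\<close>)
  obtain y where "y \<in> I j r"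
      "\<forall>m\<in>{m. l \<le> tdeg m}. sI (monomial m) y = (if tdeg m = l then b m else 0)"
    using graded_injective_extend[OF injective] by blast
  then show thesis by (intro that[of y]) (simp_all add: killed_from_def)
qed

text \<open>The monomials of degree \<open>l\<close> send \<open>a\<close> into the socle. Exactness of the socle complex and
  injectivity yield a coboundary with the same products by these monomials.\<close>

lemma killed_from_reduce_Suc:
  assumes exact: "socle_exact i (r + int l)"
    and a: "a \<in> I i r" "killed_from sI (Suc l) a" "killed_from sI l (dI i a)"
  shows "\<exists>w\<in>torsion_coboundaries i r. killed_from sI l (a - w)"
proof -
  have "dI i (sI (monomial m) a) = 0" if "tdeg m = l" for m
    using a(1,3) that by (simp add: diff.hom_scale killed_from_def)
  then have bounds: "case i of 0 \<Rightarrow> sI (monomial m) a = 0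
      | Suc j \<Rightarrow> sI (monomial m) a \<in> dI j ` socle j (r + int l)" if "tdeg m = l" for m
    using exact monomial_multiple_in_socle[OF a(1,2) that] that unfolding socle_exact_def by blast
  show ?thesis
  proof (cases i)
    case 0
    then show ?thesis using bounds by (simp add: killed_from_iff_of_Suc[OF a(2)])
  next
    case (Suc j)
    then have "\<forall>m. \<exists>b. tdeg m = l \<longrightarrow> b \<in> socle j (r + int l) \<and> sI (monomial m) a = dI j b"
      using bounds by auto
    then obtain b where b: "\<And>m. tdeg m = l \<Longrightarrow> b m \<in> socle j (r + int l)"
        "\<And>m. tdeg m = l \<Longrightarrow> sI (monomial m) a = dI j (b m)"
      by metis
    obtain y where y: "y \<in> I j r" "killed_from sI (Suc l) y"
        "\<And>m. tdeg m = l \<Longrightarrow> sI (monomial m) y = b m"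
      using injective_socle_interpolation[of l b j r] b(1) by blast
    have "killed_from sI (Suc l) (dI j y)"
      by (rule killed_from_differential[OF y(1,2)])
    then have "killed_from sI (Suc l) (a - dI j y)" by (rule I.killed_from_diff[OF a(2)])
    moreover have "sI (monomial m) (a - dI j y) = 0" if "tdeg m = l" for m
      using b(2) y(1,3) that by (simp add: I.scale_right_diff_distrib flip: diff.hom_scale)
    ultimately have "killed_from sI l (a - dI j y)" by (simp add: killed_from_iff_of_Suc)
    moreover have "dI j y \<in> torsion_coboundaries i r"
      unfolding Suc torsion_coboundaries_Suc using y(1,2) by blast
    ultimately show ?thesis by blast
  qed
qed

lemma killed_from_reduce:
  assumes exact: "\<And>r'. r' \<ge> r + int c \<Longrightarrow> socle_exact i r'"
    and "a \<in> I i r" "killed_from sI l a" "killed_from sI c (dI i a)"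
  shows "\<exists>w\<in>torsion_coboundaries i r. killed_from sI c (a - w)"
  using assms(2-)
proof (induction l arbitrary: a)
  case 0
  then have "killed_from sI c (a - 0)" using killed_from_mono[of sI 0 a c] by simp
  then show ?case using zero_in_torsion_coboundaries by blast
next
  case (Suc l)
  show ?case
  proof (cases "Suc l \<le> c")
    case True
    then have "killed_from sI c (a - 0)" using killed_from_mono[OF Suc.prems(2)] by simp
    then show ?thesis using zero_in_torsion_coboundaries by blast
  next
    case False
    then have "socle_exact i (r + int l)" "killed_from sI l (dI i a)"
      using exact killed_from_mono[OF Suc.prems(3)] by auto
    then obtain w where w: "w \<in> torsion_coboundaries i r" "killed_from sI l (a - w)"
      using killed_from_reduce_Suc[OF _ Suc.prems(1,2)] by blast
    then have "w \<in> I i r" "dI i w = 0"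
      using subsetD[OF torsion_coboundaries_subset w(1)] by (auto simp: torsion_cocycles_iff)
    then have "a - w \<in> I i r" "killed_from sI c (dI i (a - w))"
      using Suc.prems(1,3) I.diff_mem diff.hom_diff[of a i r w] by auto
    then obtain w' where w': "w' \<in> torsion_coboundaries i r" "killed_from sI c (a - w - w')"
      using Suc.IH w(2) by blast
    then show ?thesis
      using torsion_coboundaries_add[OF w(1) w'(1)] by (metis diff_diff_eq)
  qed
qed

lemma notin_cohomology_degreesI:
  assumes "\<And>r'. r' \<ge> r \<Longrightarrow> socle_exact i r'"
  shows "r \<notin> cohomology_degrees sI I dI i"
proof -
  have "z \<in> torsion_coboundaries i r" if "z \<in> torsion_cocycles i r" for z
  proof -
    obtain l where z: "z \<in> I i r" "killed_from sI l z" "dI i z = 0"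
      using \<open>z \<in> torsion_cocycles i r\<close> by (auto simp: torsion_cocycles_iff)
    then obtain w where "w \<in> torsion_coboundaries i r" "killed_from sI 0 (z - w)"
      using killed_from_reduce[of r 0 i z l] assms I.killed_from_zero by auto
    then show ?thesis by (simp add: I.killed_from_0_iff)
  qed
  then show ?thesis by (auto simp: cohomology_degrees_iff)
qed

lemma in_cohomology_degreesI:
  assumes "\<not> socle_exact i r" and exact: "\<And>j r'. i = Suc j \<Longrightarrow> r' > r \<Longrightarrow> socle_exact j r'"
  shows "r \<in> cohomology_degrees sI I dI i"
proof -
  obtain z where z: "z \<in> socle i r" "dI i z = 0"
      and no_bound: "\<not> (case i of 0 \<Rightarrow> z = 0 | Suc j \<Rightarrow> z \<in> dI j ` socle j r)"
    using assms(1) unfolding socle_exact_def by blast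
  have "z \<in> torsion_cocycles i r"
    using z unfolding socle_iff torsion_cocycles_iff by blast
  moreover have "z \<notin> torsion_coboundaries i r"
  proof
    assume bound: "z \<in> torsion_coboundaries i r"
    show False
    proof (cases i)
      case 0
      then show ?thesis using bound no_bound by simp
    next
      case (Suc j)
      then obtain y l where y: "z = dI j y" "y \<in> I j r" "killed_from sI l y"
        using bound by (auto simp: torsion_coboundaries_Suc)
      then obtain w where w: "w \<in> torsion_coboundaries j r" "killed_from sI 1 (y - w)"
        using killed_from_reduce[of r 1 j y l] exact[OF Suc] z(1) by (auto simp: socle_iff)
      then have "w \<in> I j r" "dI j w = 0"
        using subsetD[OF torsion_coboundaries_subset w(1)] by (auto simp: torsion_cocycles_iff)
      then have "y - w \<in> socle j r" "dI j (y - w) = z"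
        using w(2) y(1,2) I.diff_mem diff.hom_diff[of y j r w] by (auto simp: socle_iff)
      then show ?thesis using no_bound Suc by auto
    qed
  qed
  ultimately show ?thesis by (auto simp: cohomology_degrees_iff)
qed

lemma cohomology_degree_above_socle_degree:
  "\<not> socle_exact i r \<Longrightarrow>
   \<exists>i'\<le>i. \<exists>r'\<in>cohomology_degrees sI I dI i'. r + int i \<le> r' + int i'"
proof (induction i arbitrary: r)
  case 0
  then show ?case using in_cohomology_degreesI[of 0 r] by auto
next
  case (Suc i)
  show ?case
  proof (cases "\<forall>r'>r. socle_exact i r'")
    case True
    then have "r \<in> cohomology_degrees sI I dI (Suc i)"
      using in_cohomology_degreesI[OF Suc.prems] by blast
    then show ?thesis by blast
  next
    case False
    then obtain r1 where r1: "r1 > r" "\<not> socle_exact i r1" by blast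
    obtain i' r' where "i' \<le> i" "r' \<in> cohomology_degrees sI I dI i'" "r1 + int i \<le> r' + int i'"
      using Suc.IH[OF r1(2)] by blast
    then show ?thesis using r1(1) by (intro exI[of _ i'] conjI bexI[of _ r']) auto
  qed
qed

end

section \<open>Suprema of degrees\<close>

definition degree_Sup :: "int set \<Rightarrow> ereal" where
  "degree_Sup S = (SUP r\<in>S. ereal (real_of_int r))"

lemma degree_Sup_empty [simp]: "degree_Sup {} = -\<infinity>"
  by (simp add: degree_Sup_def bot_ereal_def)

lemma degree_Sup_add: "degree_Sup S + ereal (real_of_int c) = degree_Sup ((\<lambda>r. r + c) ` S)"
proof (cases "S = {}")
  case False
  then show ?thesis
    by (simp add: degree_Sup_def image_image flip: SUP_ereal_add_left plus_ereal.simps(1))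
qed simp

lemma degree_Sup_diff: "degree_Sup S - ereal (real_of_int c) = degree_Sup ((\<lambda>r. r - c) ` S)"
  using degree_Sup_add[of S "- c"] by (simp add: minus_ereal_def)

lemma Max_degree_Sup:
  assumes "finite ((\<lambda>j. degree_Sup (S j)) ` J)" "J \<noteq> {}"
  shows "Max ((\<lambda>j. degree_Sup (S j)) ` J) = degree_Sup (\<Union>j\<in>J. S j)"
  using assms by (simp add: Max_Sup degree_Sup_def SUP_UNION)

lemma degree_Sup_UN_eqI:
  assumes le: "\<And>i r. i \<in> A \<Longrightarrow> r \<in> S i \<Longrightarrow> \<exists>j\<in>B. \<exists>D\<in>T j. f i r \<le> g j D"
    and ge: "\<And>j D. j \<in> B \<Longrightarrow> D \<in> T j \<Longrightarrow> \<exists>i\<in>A. \<exists>r\<in>S i. g j D \<le> f i r"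
  shows "degree_Sup (\<Union>i\<in>A. f i ` S i) = degree_Sup (\<Union>j\<in>B. g j ` T j)"
  unfolding degree_Sup_def
proof (rule SUP_eq)
  show "\<exists>y\<in>(\<Union>j\<in>B. g j ` T j). ereal (real_of_int x) \<le> ereal (real_of_int y)"
    if "x \<in> (\<Union>i\<in>A. f i ` S i)" for x
    using that le by auto
  show "\<exists>x\<in>(\<Union>i\<in>A. f i ` S i). ereal (real_of_int y) \<le> ereal (real_of_int x)"
    if "y \<in> (\<Union>j\<in>B. g j ` T j)" for y
    using that ge by auto
qed

lemma a_inv_eq: "a_inv sI I dI i = degree_Sup (cohomology_degrees sI I dI i)"
  by (simp add: a_inv_def degree_Sup_def cohomology_degrees_def setcompr_eq_image)

definition generator_degrees :: "(nat \<Rightarrow> int \<Rightarrow> 'f set) \<Rightarrow> (nat \<Rightarrow> 'f set) \<Rightarrow> int \<Rightarrow> int set" where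
  "generator_degrees F B j = (if j < 0 then {} else {r. B (nat j) \<inter> F (nat j) r \<noteq> {}})"

lemma b_inv_eq: "b_inv F B j = degree_Sup (generator_degrees F B j)"
  by (simp add: b_inv_def degree_Sup_def generator_degrees_def setcompr_eq_image bot_ereal_def)

section \<open>Partial regularities\<close>

definition variables :: "'n::finite list" where
  "variables = (SOME vs. distinct vs \<and> set vs = UNIV)"

lemma distinct_variables: "distinct (variables :: 'n::finite list)"
  and set_variables: "set (variables :: 'n::finite list) = UNIV"
proof -
  have "\<exists>vs :: 'n list. distinct vs \<and> set vs = UNIV"
    using finite_distinct_list[of "UNIV :: 'n set"] by auto
  from someI_ex[OF this] show "distinct (variables :: 'n list)" "set (variables :: 'n list) = UNIV"
    by (auto simp: variables_def)
qed

lemma length_variables: "length (variables :: 'n::finite list) = CARD('n)"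
  using distinct_card[of "variables :: 'n list"] by (simp add: distinct_variables set_variables)

locale injective_and_free_resolution =
  inj: injective_resolution s M sI I \<eta> dI + free: minimal_free_resolution s M sF F B \<epsilon> \<delta>
  for s :: "('n::finite, 'k::field) mpoly \<Rightarrow> 'm::ab_group_add \<Rightarrow> 'm" and M
    and sI :: "('n, 'k) mpoly \<Rightarrow> 'e::ab_group_add \<Rightarrow> 'e" and I \<eta> dI
    and sF :: "('n, 'k) mpoly \<Rightarrow> 'f::ab_group_add \<Rightarrow> 'f" and F B \<epsilon> \<delta>
begin

lemma socle_exact_iff_koszul_acyclic:
  "inj.socle_exact i r \<longleftrightarrow> koszul_acyclic (var_scale s) M variables (int i) r"
  by (simp add: inj.koszul_acyclic_iff_socle_exact distinct_variables set_variables)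

lemma no_generator_iff_koszul_acyclic:
  "B j \<inter> F j D = {} \<longleftrightarrow>
    koszul_acyclic (var_scale s) M variables (int CARD('n) - int j) (D - int CARD('n))"
  using free.koszul_acyclic_iff_no_generator[of variables j "D - int CARD('n)"]
  by (simp add: distinct_variables set_variables length_variables)

lemma koszul_acyclic_outside:
  "p < 0 \<or> p > int CARD('n) \<Longrightarrow> koszul_acyclic (var_scale s) M variables p r"
  by (rule inj.M.koszul_acyclic_outside) (simp add: length_variables)

lemma generator_degrees_empty: "j > int CARD('n) \<Longrightarrow> generator_degrees F B j = {}"
  by (simp add: generator_degrees_def no_generator_iff_koszul_acyclic koszul_acyclic_outside)

lemma socle_exact_iff_not_generator_degree:
  "inj.socle_exact i r \<longleftrightarrow> r + int CARD('n) \<notin> generator_degrees F B (int CARD('n) - int i)"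
  by (simp add: generator_degrees_def socle_exact_iff_koszul_acyclic no_generator_iff_koszul_acyclic
      koszul_acyclic_outside)

lemma generator_degree_above_cohomology_degree:
  assumes "r \<in> cohomology_degrees sI I dI i"
  shows "\<exists>D\<in>generator_degrees F B (int CARD('n) - int i). r \<le> D - int CARD('n)"
proof -
  obtain r' where "r' \<ge> r" "\<not> inj.socle_exact i r'"
    using assms inj.notin_cohomology_degreesI by blast
  then show ?thesis
    by (intro bexI[of _ "r' + int CARD('n)"]) (simp_all add: socle_exact_iff_not_generator_degree)
qed

lemma cohomology_degree_above_generator_degree:
  assumes D: "D \<in> generator_degrees F B j"
  shows "\<exists>i. int i \<le> int CARD('n) - j \<and> (\<exists>r\<in>cohomology_degrees sI I dI i. D - j \<le> r + int i)"
proof -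
  have j: "j \<le> int CARD('n)"
    using D generator_degrees_empty[of j] by force
  then have "\<not> inj.socle_exact (nat (int CARD('n) - j)) (D - int CARD('n))"
    using D by (simp add: socle_exact_iff_not_generator_degree)
  then obtain i r where "i \<le> nat (int CARD('n) - j)" "r \<in> cohomology_degrees sI I dI i"
      "D - int CARD('n) + int (nat (int CARD('n) - j)) \<le> r + int i"
    using inj.cohomology_degree_above_socle_degree by blast
  then show ?thesis
    using j by (intro exI[of _ i] conjI bexI[of _ r]) auto
qed

lemma finite_image_generator_degrees:
  "finite ((\<lambda>j. degree_Sup ((\<lambda>D. D - c j) ` generator_degrees F B j)) ` {a..})"
proof (rule finite_subset)
  let ?f = "\<lambda>j. degree_Sup ((\<lambda>D. D - c j) ` generator_degrees F B j)"
  show "?f ` {a..} \<subseteq> insert (-\<infinity>) (?f ` {a..int CARD('n)})"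
  proof (rule image_subsetI)
    fix j assume "j \<in> {a..}"
    then show "?f j \<in> insert (-\<infinity>) (?f ` {a..int CARD('n)})"
      by (cases "j > int CARD('n)") (auto simp: generator_degrees_empty)
  qed
qed simp

lemma Max_b_inv_diff:
  "Max {b_inv F B j - ereal (real_of_int (c j)) | j. j \<ge> a} =
    degree_Sup (\<Union>j\<in>{a..}. (\<lambda>D. D - c j) ` generator_degrees F B j)"
proof -
  have "{b_inv F B j - ereal (real_of_int (c j)) | j. j \<ge> a} =
      (\<lambda>j. degree_Sup ((\<lambda>D. D - c j) ` generator_degrees F B j)) ` {a..}"
    by (auto simp: b_inv_eq degree_Sup_diff)
  then show ?thesis by (simp add: Max_degree_Sup finite_image_generator_degrees)
qed

lemma Max_a_inv_add:
  "Max {a_inv sI I dI i + ereal (real_of_int (c i)) | i. i \<le> t} =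
    degree_Sup (\<Union>i\<in>{..t}. (\<lambda>r. r + c i) ` cohomology_degrees sI I dI i)"
proof -
  have "{a_inv sI I dI i + ereal (real_of_int (c i)) | i. i \<le> t} =
      (\<lambda>i. degree_Sup ((\<lambda>r. r + c i) ` cohomology_degrees sI I dI i)) ` {..t}"
    by (auto simp: a_inv_eq degree_Sup_add)
  then show ?thesis by (simp add: Max_degree_Sup)
qed

lemma Max_weighted_a_inv_eq:
  fixes w :: "int \<Rightarrow> int"
  assumes w: "\<And>a b. a \<le> b \<Longrightarrow> w b - w a \<le> b - a"
  shows "Max {a_inv sI I dI i + ereal (real_of_int (w (int i))) | i. i \<le> t} =
    Max {b_inv F B j - ereal (real_of_int (int CARD('n) - w (int CARD('n) - j))) | j.
      j \<ge> int CARD('n) - int t}"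
  unfolding Max_a_inv_add Max_b_inv_diff
proof (rule degree_Sup_UN_eqI)
  fix i r assume i: "i \<in> {..t}" and r: "r \<in> cohomology_degrees sI I dI i"
  obtain D where "D \<in> generator_degrees F B (int CARD('n) - int i)" "r \<le> D - int CARD('n)"
    using generator_degree_above_cohomology_degree[OF r] by blast
  then show "\<exists>j\<in>{int CARD('n) - int t..}. \<exists>D\<in>generator_degrees F B j.
      r + w (int i) \<le> D - (int CARD('n) - w (int CARD('n) - j))"
    using i by (intro bexI[of _ "int CARD('n) - int i"] bexI[of _ D]) auto
next
  fix j D assume j: "j \<in> {int CARD('n) - int t..}" and D: "D \<in> generator_degrees F B j"
  obtain i r where i: "int i \<le> int CARD('n) - j"
      and r: "r \<in> cohomology_degrees sI I dI i" "D - j \<le> r + int i"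
    using cohomology_degree_above_generator_degree[OF D] by blast
  then show "\<exists>i\<in>{..t}. \<exists>r\<in>cohomology_degrees sI I dI i.
      D - (int CARD('n) - w (int CARD('n) - j)) \<le> r + w (int i)"
    using w[OF i] j by (intro bexI[of _ i] bexI[of _ r]) auto
qed

theorem partial_reg_eq:
  "partial_reg sI I dI t = Max {b_inv F B j - ereal (real_of_int j) | j. j \<ge> int CARD('n) - int t}"
  using Max_weighted_a_inv_eq[of "\<lambda>i. i" t] by (simp add: partial_reg_def)

theorem partial_a_star_eq:
  "partial_a_star sI I dI t =
    Max {b_inv F B j | j. j \<ge> int CARD('n) - int t} - ereal (real CARD('n))"
proof -
  let ?D = "\<Union>j\<in>{int CARD('n) - int t..}. generator_degrees F B j"
  have "partial_a_star sI I dI t =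
      Max {b_inv F B j - ereal (real_of_int (int CARD('n))) | j. j \<ge> int CARD('n) - int t}"
    using Max_weighted_a_inv_eq[of "\<lambda>_. 0" t] by (simp add: partial_a_star_def)
  also have "\<dots> = degree_Sup ?D - ereal (real_of_int (int CARD('n)))"
    unfolding Max_b_inv_diff degree_Sup_diff image_UN ..
  also have "degree_Sup ?D = Max {b_inv F B j | j. j \<ge> int CARD('n) - int t}"
    using Max_b_inv_diff[of "\<lambda>_. 0" "int CARD('n) - int t"] by simp
  finally show ?thesis by simp
qed

end

theorem theorem5p1:
  fixes s :: "('n::finite, 'k::field) mpoly \<Rightarrow> 'm::ab_group_add \<Rightarrow> 'm"
    and M :: "int \<Rightarrow> 'm set"
    and sI :: "('n, 'k) mpoly \<Rightarrow> 'e::ab_group_add \<Rightarrow> 'e"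
    and I :: "nat \<Rightarrow> int \<Rightarrow> 'e set"
    and \<eta> :: "'m \<Rightarrow> 'e"
    and dI :: "nat \<Rightarrow> 'e \<Rightarrow> 'e"
    and sF :: "('n, 'k) mpoly \<Rightarrow> 'f::ab_group_add \<Rightarrow> 'f"
    and F :: "nat \<Rightarrow> int \<Rightarrow> 'f set"
    and B :: "nat \<Rightarrow> 'f set"
    and \<epsilon> :: "'f \<Rightarrow> 'm"
    and \<delta> :: "nat \<Rightarrow> 'f \<Rightarrow> 'f"
    and t :: nat
  assumes "graded_module s M"
    and "finitely_generated s M"
    and "graded_injective_resolution s M sI I \<eta> dI"
    and "minimal_graded_free_resolution s M sF F B \<epsilon> \<delta>"
  shows "partial_reg sI I dI t =
           Max {b_inv F B i - ereal (real_of_int i) | i. i \<ge> int CARD('n) - int t} \<and>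
         partial_a_star sI I dI t =
           Max {b_inv F B i | i. i \<ge> int CARD('n) - int t} - ereal (real CARD('n))"
proof -
  interpret injective_and_free_resolution s M sI I \<eta> dI sF F B \<epsilon> \<delta>
    by unfold_locales fact+
  show ?thesis using partial_reg_eq partial_a_star_eq by simp
qed

end
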